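(* Let $G$ be a finite simple outerplanar graph with maximum degree $\Delta(G)=4$. Then $\lambda_2^T(G)\leq 6$, i.e. $G$ admits a $(2,1)$-total labeling $f: V(G)\cup E(G)\to\{0,1,\ldots,6\}$.
   Context: A $(2,1)$-total labeling of a graph $G$ with labels in $\{0,1,\ldots,k\}$ is a map $f: V(G)\cup E(G)\to\{0,1,\ldots,k\}$ such that $|f(x)-f(y)|\ge 2$ whenever $x$ is a vertex and $y$ is an edge incident to $x$, and $|f(x)-f(y)|\ge 1$ whenever $x,y$ are two adjacent vertices or two distinct edges sharing an end vertex. The $(2,1)$-total labeling number $\lambda_2^T(G)$ is the minimum $k$ for which such a labeling exists. A graph is outerplanar if it can be drawn in the plane without edge crossings so that all vertices lie on the boundary of one face (the outer face). *)

theory Defs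
  imports "HOL-Analysis.Analysis"
begin

section \<open>Finite simple graphs\<close>

definition finite_simple_graph :: "'a set \<Rightarrow> 'a set set \<Rightarrow> bool" where
  "finite_simple_graph V E \<longleftrightarrow> finite V \<and> (\<forall>e\<in>E. e \<subseteq> V \<and> card e = 2)"

definition degree :: "'a set set \<Rightarrow> 'a \<Rightarrow> nat" where
  "degree E v = card {e \<in> E. v \<in> e}"

text \<open>Inserting 0 only matters for the graph without vertices, where \<open>Max {}\<close> is unspecified.\<close>

definition max_degree :: "'a set \<Rightarrow> 'a set set \<Rightarrow> nat" where
  "max_degree V E = Max (insert 0 (degree E ` V))"

section \<open>Outerplanarity\<close>

text \<open>The plane is \<^typ>\<open>complex\<close>. Vertex \<open>v\<close> is drawn as the point \<open>p v\<close>, edge \<open>e\<close> as the arc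
  \<open>g e\<close>. An arc meets the drawn vertices exactly in its two end points, and two arcs meet
  exactly in the end points that they share.\<close>

definition plane_drawing ::
  "'a set \<Rightarrow> 'a set set \<Rightarrow> ('a \<Rightarrow> complex) \<Rightarrow> ('a set \<Rightarrow> real \<Rightarrow> complex) \<Rightarrow> bool" where
  "plane_drawing V E p g \<longleftrightarrow>
     inj_on p V \<and>
     (\<forall>e\<in>E. arc (g e) \<and> {pathstart (g e), pathfinish (g e)} = p ` e \<and>
            path_image (g e) \<inter> p ` V = p ` e) \<and>
     (\<forall>e\<in>E. \<forall>e'\<in>E. e \<noteq> e' \<longrightarrow> path_image (g e) \<inter> path_image (g e') = p ` (e \<inter> e'))"

definition drawing_image ::
  "'a set \<Rightarrow> 'a set set \<Rightarrow> ('a \<Rightarrow> complex) \<Rightarrow> ('a set \<Rightarrow> real \<Rightarrow> complex) \<Rightarrow> complex set" where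
  "drawing_image V E p g = p ` V \<union> (\<Union>e\<in>E. path_image (g e))"

text \<open>The image of a drawing of a finite graph is compact, so \<^const>\<open>outside\<close> of it is the unique
  unbounded component of its complement, that is, the outer face.\<close>

definition outerplanar :: "'a set \<Rightarrow> 'a set set \<Rightarrow> bool" where
  "outerplanar V E \<longleftrightarrow>
     (\<exists>p g. plane_drawing V E p g \<and> p ` V \<subseteq> frontier (outside (drawing_image V E p g)))"

section \<open>(2,1)-total labelings\<close>

text \<open>The domain \<open>V \<union> E\<close> is a disjoint union; differences are taken in \<^typ>\<open>int\<close> because
  subtraction on \<^typ>\<open>nat\<close> truncates.\<close>

definition total_labeling_2_1 ::
  "'a set \<Rightarrow> 'a set set \<Rightarrow> nat \<Rightarrow> ('a + 'a set \<Rightarrow> nat) \<Rightarrow> bool" where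
  "total_labeling_2_1 V E k f \<longleftrightarrow>
     f \<in> (V <+> E) \<rightarrow> {0..k} \<and>
     (\<forall>v\<in>V. \<forall>e\<in>E. v \<in> e \<longrightarrow> \<bar>int (f (Inl v)) - int (f (Inr e))\<bar> \<ge> 2) \<and>
     (\<forall>u\<in>V. \<forall>v\<in>V. {u, v} \<in> E \<longrightarrow> \<bar>int (f (Inl u)) - int (f (Inl v))\<bar> \<ge> 1) \<and>
     (\<forall>e\<in>E. \<forall>e'\<in>E. e \<noteq> e' \<and> e \<inter> e' \<noteq> {} \<longrightarrow> \<bar>int (f (Inr e)) - int (f (Inr e'))\<bar> \<ge> 1)"

definition total_labeling_number_2_1 :: "'a set \<Rightarrow> 'a set set \<Rightarrow> nat" where
  "total_labeling_number_2_1 V E = (LEAST k. \<exists>f. total_labeling_2_1 V E k f)"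

end

theory Submission imports Defs begin

text \<open>Induction on the number of edges. In an outerplanar drawing every vertex lies on the closure of
  the outer face, and Janiszewski's theorem shows that three arcs with common ends cannot all carry a
  further vertex there; so \<open>G\<close> contains no subdivided \<open>K\<^sub>2\<^sub>,\<^sub>3\<close>, and no cycle with two crossing chords.
  Hence, if no vertex has degree 1, a longest cycle of an end block has no branches except at one
  vertex, and its chords do not cross. An innermost nontrivial chord then yields two adjacent vertices of
  degree 2, or a triangle with vertices of degrees 2 and 3, or two triangles with a common vertex of
  degree 4 and a vertex of degree 2 each. After deletion of some edges of such a configuration, a
  labeling of the rest extends, possibly after relabeling the whole configuration. At a boundary
  vertex only its label and the labels still available for its edges matter, which leaves a finite
  check.\<close>

section \<open>Theta curves and the outer face\<close>

text \<open>The difficulty on the labeling side is the lack of slack. Among the labels 0 to 6 a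
  vertex label strictly between 0 and 6 leaves only four edge labels, and 0 and 6 leave five. So the
  missing edges at a boundary vertex of degree 4 may have just one label set available, and all
  freedom has to come from the inner vertices of the configuration, whose old labels are discarded.
  With two triangles, or with a triangle having a vertex of degree 3, deleting every edge of the
  configuration would go too far: some sets left at the two boundary vertices admit no extension at
  all. Therefore a path of two edges joining these vertices stays in the smaller graph. Its labels
  are later thrown away, but their mere existence rules out the bad sets. On the topological side
  everything rests on one fact: a vertex approached by the outer face is never inside a closed curve
  of the drawing.\<close>

lemma closure_meets_open:
  assumes "x \<in> closure A" "open B" "x \<in> B"
  shows "A \<inter> B \<noteq> {}"
  using assms open_Int_closure_eq_empty by blast

text \<open>The inside of \<open>S\<close> is open, so a point of it approached by the outside of
  \<open>T\<close> would have outside points of \<open>T\<close> near it inside \<open>S\<close>.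
  But a larger set has a smaller outside.\<close>

lemma inside_not_closure_outside:
  fixes S T :: "complex set"
  assumes "closed S" "S \<subseteq> T" "v \<in> closure (outside T)"
  shows "v \<notin> inside S"
proof
  assume "v \<in> inside S"
  then have "outside T \<inter> inside S \<noteq> {}"
    using closure_meets_open assms open_inside by blast
  then show False
    using outside_mono[OF assms(2)] inside_Int_outside by blast
qed

lemma theta_closed_curve:
  fixes c1 c2 :: "real \<Rightarrow> complex"
  assumes "arc c1" "arc c2" "pathstart c1 = a" "pathfinish c1 = b" "pathstart c2 = a" "pathfinish c2 = b"
    and "path_image c1 \<inter> path_image c2 = {a, b}"
  shows "connected (inside (path_image c1 \<union> path_image c2))"
    and "frontier (inside (path_image c1 \<union> path_image c2)) = path_image c1 \<union> path_image c2"
proof -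
  let ?c = "c1 +++ reversepath c2"
  have sp: "simple_path ?c"
    by (rule simple_path_join_loop) (use assms in \<open>auto simp: arc_reversepath\<close>)
  have cl: "pathfinish ?c = pathstart ?c" using assms by simp
  have im: "path_image ?c = path_image c1 \<union> path_image c2"
    using assms by (simp add: path_image_join)
  show "connected (inside (path_image c1 \<union> path_image c2))"
    and "frontier (inside (path_image c1 \<union> path_image c2)) = path_image c1 \<union> path_image c2"
    using Jordan_inside_outside[OF sp cl] im by auto
qed

text \<open>If the middle arc avoided the inside of the other two, then near \<open>v1\<close> the inside of
  \<open>c1 \<union> c3\<close> and the outside of the theta curve could be joined both in the complement of
  \<open>c1 \<union> m\<close> and in the complement of \<open>m \<union> c3\<close>, hence, by Janiszewski's theorem, in the complement
  of the theta curve.\<close>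

lemma theta_middle_meets_inside:
  fixes c1 c3 m :: "real \<Rightarrow> complex"
  assumes arcs: "arc c1" "arc c3" "arc m"
    and ends: "pathstart c1 = a" "pathfinish c1 = b" "pathstart c3 = a" "pathfinish c3 = b"
      "pathstart m = a" "pathfinish m = b"
    and meet: "path_image c1 \<inter> path_image c3 = {a, b}" "path_image c1 \<inter> path_image m = {a, b}"
      "path_image c3 \<inter> path_image m = {a, b}"
    and sub: "path_image c1 \<union> path_image c3 \<union> path_image m \<subseteq> D"
    and v1: "v1 \<in> path_image c1 - {a, b}" "v1 \<in> closure (outside D)"
    and v3: "v3 \<in> path_image c3 - {a, b}" "v3 \<in> closure (outside D)"
  shows "path_image m \<inter> inside (path_image c1 \<union> path_image c3) \<noteq> {}"
proof
  let ?C1 = "path_image c1" and ?C3 = "path_image c3" and ?M = "path_image m"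
  let ?T = "?C1 \<union> ?C3 \<union> ?M"
  assume none: "?M \<inter> inside (?C1 \<union> ?C3) = {}"
  have comp: "compact ?C1" "compact ?C3" "compact ?M"
    using arcs by (simp_all add: compact_arc_image)
  have outD: "outside D \<subseteq> outside ?T" by (rule outside_mono[OF sub])
  have cl1: "v1 \<in> closure (outside ?T)" and cl3: "v3 \<in> closure (outside ?T)"
    using v1 v3 closure_mono[OF outD] by auto
  have clo: "closed (?C1 \<union> ?M)" "closed (?M \<union> ?C3)" "bounded (?C1 \<union> ?M)"
    using comp by (auto simp: compact_imp_closed closed_Un compact_imp_bounded)
  let ?I = "inside (?C1 \<union> ?C3)"
  have I: "connected ?I" "frontier ?I = ?C1 \<union> ?C3"
    using theta_closed_curve[OF arcs(1,2) ends(1-4) meet(1)] by auto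
  have clI: "?C1 \<union> ?C3 \<subseteq> closure ?I" using I(2) by (auto simp: frontier_def)
  \<comment> \<open>The connected set \<open>?I\<close> avoids \<open>c1 \<union> m\<close> and
    accumulates at \<open>v3\<close>. Once \<open>v3\<close> is known to be outside that curve, so
    is one point of \<open>?I\<close>, and hence all of \<open>?I\<close>.\<close>
  have "v3 \<notin> inside (?C1 \<union> ?M)"
    by (rule inside_not_closure_outside[OF clo(1) _ cl3]) auto
  moreover have "v3 \<notin> ?C1 \<union> ?M" using v3(1) meet(1,3) by blast
  ultimately have v3o: "v3 \<in> outside (?C1 \<union> ?M)"
    using inside_Un_outside[of "?C1 \<union> ?M"] by blast
  have "?I \<inter> outside (?C1 \<union> ?M) \<noteq> {}"
    by (rule closure_meets_open[of v3]) (use v3 clI v3o clo open_outside in auto)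
  then obtain z where z: "z \<in> ?I" "z \<in> outside (?C1 \<union> ?M)" by blast
  have Idis: "?I \<subseteq> - (?C1 \<union> ?M)"
    using none inside_no_overlap[of "?C1 \<union> ?C3"] by blast
  have Iout: "?I \<subseteq> outside (?C1 \<union> ?M)"
  proof
    fix x assume "x \<in> ?I"
    then have "connected_component (- (?C1 \<union> ?M)) z x"
      using I(1) Idis z by (meson connected_component_def)
    then show "x \<in> outside (?C1 \<union> ?M)" using z(2) outside_same_component by blast
  qed
  \<comment> \<open>Both \<open>?I\<close> and the outside of the theta curve accumulate at
    \<open>v1\<close>, so a ball around \<open>v1\<close> that misses \<open>m \<union> c3\<close>
    connects a point of one to a point of the other.\<close>
  have "v1 \<in> - (?M \<union> ?C3)" using v1(1) meet(1,2) by blast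
  then obtain e where e: "e > 0" "ball v1 e \<subseteq> - (?M \<union> ?C3)"
    using openE[OF open_Compl[OF clo(2)]] by blast
  have v1I: "v1 \<in> closure ?I" and v1b: "v1 \<in> ball v1 e" using v1(1) clI e(1) by auto
  have "?I \<inter> ball v1 e \<noteq> {}" "outside ?T \<inter> ball v1 e \<noteq> {}"
    using closure_meets_open[OF v1I open_ball v1b] closure_meets_open[OF cl1 open_ball v1b] by auto
  then obtain x y where x: "x \<in> ?I" "x \<in> ball v1 e" and y: "y \<in> outside ?T" "y \<in> ball v1 e" by blast
  have cT: "connected_component (- (?M \<union> ?C3)) x y"
    unfolding connected_component_def using e(2) x(2) y(2)
    by (intro exI[of _ "ball v1 e"]) (auto simp del: mem_ball)
  have yo: "y \<in> outside (?C1 \<union> ?M)" using y(1) outside_mono[of "?C1 \<union> ?M" ?T] by auto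
  have "connected (outside (?C1 \<union> ?M))" by (rule connected_outside[OF clo(3)]) simp
  then have cS: "connected_component (- (?C1 \<union> ?M)) x y"
    unfolding connected_component_def
    using yo subsetD[OF Iout x(1)] outside_no_overlap[of "?C1 \<union> ?M"]
    by (intro exI[of _ "outside (?C1 \<union> ?M)"]) blast
  have "(?C1 \<union> ?M) \<inter> (?M \<union> ?C3) = ?M" using meet by blast
  then have "connected ((?C1 \<union> ?M) \<inter> (?M \<union> ?C3))"
    using arcs by (simp add: connected_arc_image)
  then have "connected_component (- ((?C1 \<union> ?M) \<union> (?M \<union> ?C3))) x y"
    using Janiszewski[OF _ clo(2) _ cS cT] comp by (simp add: compact_Un)
  moreover have "(?C1 \<union> ?M) \<union> (?M \<union> ?C3) = ?T" by blast
  ultimately have "connected_component (- ?T) y x"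
    by (simp add: connected_component_sym)
  then have "x \<in> outside ?T" using y(1) outside_same_component by blast
  then have "x \<in> outside (?C1 \<union> ?C3)" using outside_mono[of "?C1 \<union> ?C3" ?T] by auto
  then show False using x(1) inside_Int_outside by blast
qed

text \<open>An arc that meets the closed curve only in its ends cannot leave the inside once it has
  entered, and the entry comes from \<open>theta_middle_meets_inside\<close>.\<close>

lemma theta_middle_inside:
  fixes c1 c3 m :: "real \<Rightarrow> complex"
  assumes arcs: "arc c1" "arc c3" "arc m"
    and ends: "pathstart c1 = a" "pathfinish c1 = b" "pathstart c3 = a" "pathfinish c3 = b"
      "pathstart m = a" "pathfinish m = b"
    and meet: "path_image c1 \<inter> path_image c3 = {a, b}" "path_image c1 \<inter> path_image m = {a, b}"
      "path_image c3 \<inter> path_image m = {a, b}"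
    and sub: "path_image c1 \<union> path_image c3 \<union> path_image m \<subseteq> D"
    and v1: "v1 \<in> path_image c1 - {a, b}" "v1 \<in> closure (outside D)"
    and v3: "v3 \<in> path_image c3 - {a, b}" "v3 \<in> closure (outside D)"
  shows "path_image m - {a, b} \<subseteq> inside (path_image c1 \<union> path_image c3)"
proof -
  have ne: "path_image m \<inter> inside (path_image c1 \<union> path_image c3) \<noteq> {}"
    by (rule theta_middle_meets_inside[where a = a and b = b and D = D and ?v1.0 = v1 and ?v3.0 = v3])
       (use assms in auto)
  have ab: "a \<noteq> b" using arcs ends arc_distinct_ends by blast
  show ?thesis
    by (rule split_inside_simple_closed_curve[of c1 a b c3 m])
       (use assms ne ab arc_imp_simple_path in auto)
qed

text \<open>The points \<open>v1\<close> and \<open>v3\<close> force \<open>c2\<close> into the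
  inside of the other two arcs, where the outer face cannot approach \<open>v2\<close>.\<close>

lemma no_theta_on_outer_face:
  fixes c1 c2 c3 :: "real \<Rightarrow> complex"
  assumes arcs: "arc c1" "arc c2" "arc c3"
    and ends: "pathstart c1 = a" "pathfinish c1 = b" "pathstart c2 = a" "pathfinish c2 = b"
      "pathstart c3 = a" "pathfinish c3 = b"
    and meet: "path_image c1 \<inter> path_image c2 = {a, b}" "path_image c1 \<inter> path_image c3 = {a, b}"
      "path_image c2 \<inter> path_image c3 = {a, b}"
    and sub: "path_image c1 \<union> path_image c2 \<union> path_image c3 \<subseteq> D"
    and v1: "v1 \<in> path_image c1 - {a, b}" "v1 \<in> closure (outside D)"
    and v2: "v2 \<in> path_image c2 - {a, b}" "v2 \<in> closure (outside D)"
    and v3: "v3 \<in> path_image c3 - {a, b}" "v3 \<in> closure (outside D)"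
  shows False
proof -
  have "path_image c2 - {a, b} \<subseteq> inside (path_image c1 \<union> path_image c3)"
    by (rule theta_middle_inside[where D = D and ?v1.0 = v1 and ?v3.0 = v3]) (use assms in auto)
  then have "v2 \<in> inside (path_image c1 \<union> path_image c3)" using v2(1) by blast
  moreover have "closed (path_image c1 \<union> path_image c3)"
    using arcs by (auto simp: closed_arc_image)
  ultimately show False
    using inside_not_closure_outside[of "path_image c1 \<union> path_image c3" D v2] v2 sub by blast
qed

text \<open>By continuity and density of the open interval. It carries information on the open arc
  over to its ends.\<close>

lemma arc_ends_closure_endless:
  fixes e :: "real \<Rightarrow> complex"
  assumes "arc e" "pathstart e = a" "pathfinish e = b"
  shows "a \<in> closure (path_image e - {a, b})" "b \<in> closure (path_image e - {a, b})"
proof -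
  have inj: "inj_on e {0..1}" and con: "continuous_on {0..1} e"
    using assms by (auto simp: arc_def path_def)
  have "e ` {0<..<1} \<subseteq> path_image e - {a, b}"
    using assms inj by (fastforce simp: path_image_def pathstart_def pathfinish_def inj_on_def)
  then have "closure (e ` {0<..<1}) \<subseteq> closure (path_image e - {a, b})" by (rule closure_mono)
  moreover have "e ` {0..1} \<subseteq> closure (e ` {0<..<1})"
    using image_closure_subset[of "{0<..<1::real}" e "closure (e ` {0<..<1})"] con
    by (simp add: closure_subset)
  moreover have "a \<in> e ` {0..1}" "b \<in> e ` {0..1}"
    using assms by (auto simp: pathstart_def pathfinish_def)
  ultimately show "a \<in> closure (path_image e - {a, b})" "b \<in> closure (path_image e - {a, b})" by blast+
qed

text \<open>The arc \<open>m\<close> cuts the inside of \<open>c1 \<union> c3\<close> in two, and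
  the open arc \<open>e\<close>, being connected, lies in one half. One end of \<open>e\<close> is
  in the closure of that half but off its boundary curve, hence inside this curve, where the outer
  face cannot approach it.\<close>

lemma no_crossing_on_outer_face:
  fixes c1 c3 m e :: "real \<Rightarrow> complex"
  assumes arcs: "arc c1" "arc c3" "arc m" "arc e"
    and ends: "pathstart c1 = a" "pathfinish c1 = b" "pathstart c3 = a" "pathfinish c3 = b"
      "pathstart m = a" "pathfinish m = b" "pathstart e = v1" "pathfinish e = v3"
    and meet: "path_image c1 \<inter> path_image c3 = {a, b}" "path_image c1 \<inter> path_image m = {a, b}"
      "path_image c3 \<inter> path_image m = {a, b}" "path_image e \<inter> path_image m = {}"
    and sub: "path_image c1 \<union> path_image c3 \<union> path_image m \<subseteq> D"
    and v1: "v1 \<in> path_image c1 - {a, b}" "v1 \<in> closure (outside D)"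
    and v3: "v3 \<in> path_image c3 - {a, b}" "v3 \<in> closure (outside D)"
    and e_in: "path_image e - {v1, v3} \<subseteq> inside (path_image c1 \<union> path_image c3)"
  shows False
proof -
  let ?C1 = "path_image c1" and ?C3 = "path_image c3" and ?M = "path_image m"
  have ne: "?M \<inter> inside (?C1 \<union> ?C3) \<noteq> {}"
    by (rule theta_middle_meets_inside[where a = a and b = b and D = D and ?v1.0 = v1 and ?v3.0 = v3])
       (use assms in auto)
  have ab: "a \<noteq> b" using arcs ends arc_distinct_ends by blast
  let ?I1 = "inside (?C1 \<union> ?M)" and ?I3 = "inside (?C3 \<union> ?M)"
  have split: "?I1 \<inter> ?I3 = {}" "?I1 \<union> ?I3 \<union> (?M - {a, b}) = inside (?C1 \<union> ?C3)"
    using split_inside_simple_closed_curve[of c1 a b c3 m] assms ne ab arc_imp_simple_path by metis+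
  have clo: "closed (?C1 \<union> ?M)" "closed (?C3 \<union> ?M)"
    using arcs by (auto simp: closed_arc_image)
  let ?e = "path_image e - {v1, v3}"
  have "connected ?e"
    using connected_simple_path_endless[OF arc_imp_simple_path[OF arcs(4)]] ends by simp
  moreover have "?e \<subseteq> ?I1 \<union> ?I3" using e_in split(2) meet(4) by blast
  ultimately have cases: "?e \<subseteq> ?I1 \<or> ?e \<subseteq> ?I3"
    using connectedD[of ?e ?I1 ?I3] open_inside[OF clo(1)] open_inside[OF clo(2)] split(1) by blast
  have key: False if "closed (X \<union> ?M)" "?e \<subseteq> inside (X \<union> ?M)" "v \<in> closure ?e" "v \<in> closure (outside D)"
    "v \<notin> X \<union> ?M" "X \<union> ?M \<subseteq> D" for X v
  proof -
    have "v \<in> closure (inside (X \<union> ?M))" using that closure_mono by blast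
    then have "v \<in> inside (X \<union> ?M)"
      using closure_inside_subset[OF that(1)] that(5) by blast
    then show False using inside_not_closure_outside[OF that(1,6,4)] by blast
  qed
  note cl = arc_ends_closure_endless[OF arcs(4) ends(7,8)]
  have "v3 \<notin> ?C1 \<union> ?M" "v1 \<notin> ?C3 \<union> ?M" using v1(1) v3(1) meet(1-3) by auto
  then show False
    using cases key[OF clo(1) _ cl(2) v3(2)] key[OF clo(2) _ cl(1) v1(2)] sub by auto
qed

section \<open>Subgraphs excluded by an outerplanar drawing\<close>

abbreviation walk :: "'a set set \<Rightarrow> 'a list \<Rightarrow> bool" where
  "walk E \<equiv> successively (\<lambda>u v. {u, v} \<in> E)"

fun path_edges :: "'a list \<Rightarrow> 'a set set" where
  "path_edges (x # y # zs) = insert {x, y} (path_edges (y # zs))"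
| "path_edges _ = {}"

text \<open>The single \<open>distinct\<close> makes the ends different and the three paths
  internally disjoint. Each path has an inner vertex because that vertex serves as its contact with
  the outer face.\<close>

definition no_theta :: "'a set set \<Rightarrow> bool" where
  "no_theta E \<longleftrightarrow> (\<nexists>a b P Q R. P \<noteq> [] \<and> Q \<noteq> [] \<and> R \<noteq> [] \<and> distinct (a # b # P @ Q @ R) \<and>
     walk E (a # P @ [b]) \<and> walk E (a # Q @ [b]) \<and> walk E (a # R @ [b]))"

text \<open>Single edges suffice as chords: a chord with inner vertices would form, with the two
  halves of the cycle, the pattern already excluded by \<open>no_theta\<close>.\<close>

definition no_crossing :: "'a set set \<Rightarrow> bool" where
  "no_crossing E \<longleftrightarrow> (\<nexists>a P b Q c R d S. distinct (a # P @ b # Q @ c # R @ d # S) \<and>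
     walk E (a # P @ b # Q @ c # R @ d # S @ [a]) \<and> {a, c} \<in> E \<and> {b, d} \<in> E)"

lemma walk_rev: "walk E (rev xs) = walk E xs"
  by (simp add: insert_commute)

lemma walk_mono: "walk E xs \<Longrightarrow> E \<subseteq> F \<Longrightarrow> walk F xs"
  by (erule successively_mono) auto

lemma walk_append: "walk E (xs @ y # zs) \<longleftrightarrow> walk E (xs @ [y]) \<and> walk E (y # zs)"
  by (auto simp: successively_append_iff)

lemma no_theta_mono:
  assumes "no_theta F" "E \<subseteq> F"
  shows "no_theta E"
  unfolding no_theta_def
proof (intro notI, elim exE conjE)
  fix a b P Q R
  assume h: "P \<noteq> []" "Q \<noteq> []" "R \<noteq> []" "distinct (a # b # P @ Q @ R)"
    and w: "walk E (a # P @ [b])" "walk E (a # Q @ [b])" "walk E (a # R @ [b])"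
  show False
    using assms(1) h w[THEN walk_mono[OF _ assms(2)]] unfolding no_theta_def by blast
qed

lemma no_crossing_mono:
  assumes "no_crossing F" "E \<subseteq> F"
  shows "no_crossing E"
  unfolding no_crossing_def
proof (intro notI, elim exE conjE)
  fix a P b Q c R d S
  assume h: "distinct (a # P @ b # Q @ c # R @ d # S)"
    and w: "walk E (a # P @ b # Q @ c # R @ d # S @ [a])" and e: "{a, c} \<in> E" "{b, d} \<in> E"
  show False
    using assms(1) h walk_mono[OF w assms(2)] e[THEN subsetD[OF assms(2)]]
    unfolding no_crossing_def by blast
qed

lemma path_edges_append: "path_edges (xs @ y # zs) = path_edges (xs @ [y]) \<union> path_edges (y # zs)"
proof (induction xs)
  case (Cons x xs)
  then show ?case by (cases xs) auto
qed simp

lemma path_edges_rev: "path_edges (rev xs) = path_edges xs"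
proof (induction xs rule: path_edges.induct)
  case (1 x y zs)
  have "path_edges (rev (x # y # zs)) = path_edges (rev zs @ y # [x])" by simp
  also have "\<dots> = path_edges (rev (y # zs)) \<union> {{y, x}}"
    by (subst path_edges_append) simp
  also have "\<dots> = path_edges (x # y # zs)" using 1 by (simp add: insert_commute)
  finally show ?case .
qed auto

lemma walk_path_edges: "walk E xs \<Longrightarrow> path_edges xs \<subseteq> E"
  by (induction xs rule: path_edges.induct) auto

lemma Union_path_edges: "2 \<le> length xs \<Longrightarrow> \<Union> (path_edges xs) = set xs"
proof (induction xs rule: path_edges.induct)
  case (1 x y zs)
  then show ?case by (cases zs) auto
qed auto

lemma path_edges_card: "distinct xs \<Longrightarrow> e \<in> path_edges xs \<Longrightarrow> card e = 2 \<and> e \<subseteq> set xs"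
  by (induction xs rule: path_edges.induct) auto

lemma ends_not_path_edge:
  assumes "P \<noteq> []" "distinct (a # P @ [b])"
  shows "{a, b} \<notin> path_edges (a # P @ [b])"
proof -
  obtain x xs where P: "P = x # xs" using assms(1) by (cases P) auto
  have "a \<notin> set (x # xs @ [b])" using assms P by auto
  then have "{a, b} \<notin> path_edges (x # xs @ [b])"
    using path_edges_card[of "x # xs @ [b]" "{a, b}"] assms P by auto
  then show ?thesis using assms P by (auto simp: doubleton_eq_iff)
qed

text \<open>A common edge could only join \<open>a\<close> to \<open>b\<close>, and a path with an
  inner vertex does not use that edge. \<open>Q\<close> may be empty, so a chord is covered as
  well.\<close>

lemma disjoint_path_edges:
  assumes "P \<noteq> []" "distinct (a # b # P @ Q)"
  shows "path_edges (a # P @ [b]) \<inter> path_edges (a # Q @ [b]) = {}"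
proof (rule ccontr)
  assume "\<not> ?thesis"
  then obtain e where e: "e \<in> path_edges (a # P @ [b])" "e \<in> path_edges (a # Q @ [b])" by blast
  have "card e = 2" "e \<subseteq> {a, b}" "a \<noteq> b"
    using path_edges_card[OF _ e(1)] path_edges_card[OF _ e(2)] assms(2) by auto
  then have "e = {a, b}" by (intro card_subset_eq) auto
  then show False using ends_not_path_edge[of P a b] assms e(1) by auto
qed

section \<open>Paths of the graph as arcs of the drawing\<close>

locale drawing =
  fixes V :: "'a set" and E :: "'a set set" and p :: "'a \<Rightarrow> complex"
    and g :: "'a set \<Rightarrow> real \<Rightarrow> complex"
  assumes simple: "finite_simple_graph V E" and plane: "plane_drawing V E p g"
    and outer: "p ` V \<subseteq> frontier (outside (drawing_image V E p g))"
begin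

abbreviation "D \<equiv> drawing_image V E p g"

definition drawn :: "'a list \<Rightarrow> complex set" where
  "drawn xs = (\<Union>e\<in>path_edges xs. path_image (g e))"

lemma edge_in_V: "e \<in> E \<Longrightarrow> e \<subseteq> V"
  using simple by (auto simp: finite_simple_graph_def)

lemma edge_arc_image:
  assumes "e \<in> E"
  shows "arc (g e)" "{pathstart (g e), pathfinish (g e)} = p ` e" "path_image (g e) \<inter> p ` V = p ` e"
  using plane assms by (simp_all add: plane_drawing_def)

lemma edge_arcs_Int: "e \<in> E \<Longrightarrow> e' \<in> E \<Longrightarrow> e \<noteq> e' \<Longrightarrow> path_image (g e) \<inter> path_image (g e') = p ` (e \<inter> e')"
  using plane by (simp add: plane_drawing_def)

lemma walk_in_V: "walk E xs \<Longrightarrow> 2 \<le> length xs \<Longrightarrow> set xs \<subseteq> V"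
  using walk_path_edges[of E xs] Union_path_edges[of xs] edge_in_V by blast

lemma drawn_subset: "walk E xs \<Longrightarrow> drawn xs \<subseteq> D"
  using walk_path_edges[of E xs] by (auto simp: drawn_def drawing_image_def)

lemma closure_outer: "v \<in> V \<Longrightarrow> p v \<in> closure (outside D)"
  using outer by (auto simp: frontier_def)

lemma p_eq: "u \<in> V \<Longrightarrow> v \<in> V \<Longrightarrow> p u = p v \<longleftrightarrow> u = v"
  using plane by (auto simp: plane_drawing_def inj_on_def)

lemma drawn_vertex:
  assumes "walk E xs" "2 \<le> length xs" "v \<in> set xs"
  shows "p v \<in> drawn xs"
proof -
  obtain e where e: "e \<in> path_edges xs" "v \<in> e" using Union_path_edges[OF assms(2)] assms(3) by blast
  then have "p v \<in> path_image (g e)"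
    using edge_arc_image(3)[of e] walk_path_edges[OF assms(1)] by blast
  then show ?thesis using e(1) unfolding drawn_def by blast
qed

lemma drawn_Int:
  assumes "walk E xs" "walk E ys" "2 \<le> length xs" "2 \<le> length ys"
    and dis: "path_edges xs \<inter> path_edges ys = {}"
  shows "drawn xs \<inter> drawn ys = p ` (set xs \<inter> set ys)"
proof -
  have "path_image (g e) \<inter> path_image (g e') = p ` (e \<inter> e')"
    if "e \<in> path_edges xs" "e' \<in> path_edges ys" for e e'
  proof -
    have "e \<noteq> e'" "e \<in> E" "e' \<in> E"
      using that dis walk_path_edges[OF assms(1)] walk_path_edges[OF assms(2)] by blast+
    then show ?thesis by (rule edge_arcs_Int[rotated 2])
  qed
  moreover have "drawn xs \<inter> drawn ys =
      (\<Union>e\<in>path_edges xs. \<Union>e'\<in>path_edges ys. path_image (g e) \<inter> path_image (g e'))"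
    unfolding drawn_def by blast
  ultimately have "drawn xs \<inter> drawn ys = (\<Union>e\<in>path_edges xs. \<Union>e'\<in>path_edges ys. p ` (e \<inter> e'))"
    by simp
  also have "\<dots> = p ` (\<Union> (path_edges xs) \<inter> \<Union> (path_edges ys))" by blast
  finally show ?thesis using assms by (simp add: Union_path_edges)
qed

text \<open>The drawing fixes no direction for \<open>g e\<close>, whereas joining arcs along a walk
  requires one.\<close>

lemma edge_arc:
  assumes "{x, y} \<in> E"
  obtains \<gamma> where "arc \<gamma>" "pathstart \<gamma> = p x" "pathfinish \<gamma> = p y" "path_image \<gamma> = path_image (g {x, y})"
proof -
  have a: "arc (g {x, y})" "{pathstart (g {x, y}), pathfinish (g {x, y})} = {p x, p y}"
    using edge_arc_image(1,2)[OF assms] by simp_all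
  show thesis
  proof (cases "pathstart (g {x, y}) = p x")
    case True
    then show thesis using that[of "g {x, y}"] a by (auto simp: doubleton_eq_iff)
  next
    case False
    then show thesis using that[of "reversepath (g {x, y})"] a
      by (auto simp: doubleton_eq_iff arc_reversepath)
  qed
qed

lemma walk_arc:
  assumes "walk E xs" "distinct xs" "2 \<le> length xs"
  shows "\<exists>\<gamma>. arc \<gamma> \<and> pathstart \<gamma> = p (hd xs) \<and> pathfinish \<gamma> = p (last xs) \<and> path_image \<gamma> = drawn xs"
  using assms
proof (induction xs rule: path_edges.induct)
  case (1 x y zs)
  obtain \<gamma> where \<gamma>: "arc \<gamma>" "pathstart \<gamma> = p x" "pathfinish \<gamma> = p y" "path_image \<gamma> = path_image (g {x, y})"
    using edge_arc 1 by (metis successively.simps(3))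
  show ?case
  proof (cases "zs = []")
    case True
    then show ?thesis using \<gamma> by (auto simp: drawn_def)
  next
    case False
    then have len: "2 \<le> length (y # zs)" by (cases zs) auto
    then obtain \<delta> where \<delta>: "arc \<delta>" "pathstart \<delta> = p y" "pathfinish \<delta> = p (last (y # zs))"
      "path_image \<delta> = drawn (y # zs)"
      using 1 by auto
    have xy: "path_edges [x, y] \<inter> path_edges (y # zs) = {}"
      using path_edges_card[of "y # zs"] 1 by auto
    have "drawn [x, y] \<inter> drawn (y # zs) = p ` (set [x, y] \<inter> set (y # zs))"
      by (rule drawn_Int) (use 1 len xy in auto)
    then have "path_image \<gamma> \<inter> path_image \<delta> \<subseteq> {pathstart \<delta>}"
      using \<gamma> \<delta> 1 by (auto simp: drawn_def)
    then have "arc (\<gamma> +++ \<delta>)" using arc_join \<gamma> \<delta> by metis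
    then show ?thesis using \<gamma> \<delta> False
      by (intro exI[of _ "\<gamma> +++ \<delta>"]) (auto simp: path_image_join drawn_def)
  qed
qed auto

lemma path_arc:
  assumes "walk E (a # P @ [b])" "distinct (a # P @ [b])"
  obtains \<gamma> where "arc \<gamma>" "pathstart \<gamma> = p a" "pathfinish \<gamma> = p b" "path_image \<gamma> = drawn (a # P @ [b])"
  using walk_arc[OF assms] by auto

lemma parallel_paths_Int:
  assumes "walk E (a # P @ [b])" "walk E (a # Q @ [b])" "P \<noteq> []" "distinct (a # b # P @ Q)"
  shows "drawn (a # P @ [b]) \<inter> drawn (a # Q @ [b]) = {p a, p b}"
proof -
  have "set (a # P @ [b]) \<inter> set (a # Q @ [b]) = {a, b}" using assms(4) by auto
  then show ?thesis using drawn_Int[OF assms(1,2)] disjoint_path_edges[OF assms(3,4)] by simp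
qed

lemma inner_vertex:
  assumes "walk E (a # P @ [b])" "distinct (a # P @ [b])" "v \<in> set P"
  shows "p v \<in> drawn (a # P @ [b]) - {p a, p b}" "p v \<in> closure (outside D)"
proof -
  have "set (a # P @ [b]) \<subseteq> V" using walk_in_V[OF assms(1)] by simp
  then show "p v \<in> drawn (a # P @ [b]) - {p a, p b}" "p v \<in> closure (outside D)"
    using assms drawn_vertex[OF assms(1), of v] closure_outer p_eq by auto
qed

lemma drawing_no_theta: "no_theta E"
  unfolding no_theta_def
proof (intro notI, elim exE conjE)
  fix a b P Q R
  assume ne: "P \<noteq> []" "Q \<noteq> []" "R \<noteq> []" and dis: "distinct (a # b # P @ Q @ R)"
    and w: "walk E (a # P @ [b])" "walk E (a # Q @ [b])" "walk E (a # R @ [b])"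
  have d: "distinct (a # P @ [b])" "distinct (a # Q @ [b])" "distinct (a # R @ [b])"
    using dis by auto
  have dd: "distinct (a # b # P @ Q)" "distinct (a # b # P @ R)" "distinct (a # b # Q @ R)"
    using dis by auto
  obtain c1 where c1: "arc c1" "pathstart c1 = p a" "pathfinish c1 = p b" "path_image c1 = drawn (a # P @ [b])"
    using path_arc[OF w(1) d(1)] by blast
  obtain c2 where c2: "arc c2" "pathstart c2 = p a" "pathfinish c2 = p b" "path_image c2 = drawn (a # Q @ [b])"
    using path_arc[OF w(2) d(2)] by blast
  obtain c3 where c3: "arc c3" "pathstart c3 = p a" "pathfinish c3 = p b" "path_image c3 = drawn (a # R @ [b])"
    using path_arc[OF w(3) d(3)] by blast
  have m: "path_image c1 \<inter> path_image c2 = {p a, p b}" "path_image c1 \<inter> path_image c3 = {p a, p b}"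
    "path_image c2 \<inter> path_image c3 = {p a, p b}"
    unfolding c1(4) c2(4) c3(4)
    using parallel_paths_Int[OF w(1,2) ne(1) dd(1)] parallel_paths_Int[OF w(1,3) ne(1) dd(2)]
      parallel_paths_Int[OF w(2,3) ne(2) dd(3)] by blast+
  have s: "path_image c1 \<union> path_image c2 \<union> path_image c3 \<subseteq> D"
    unfolding c1(4) c2(4) c3(4) using drawn_subset[OF w(1)] drawn_subset[OF w(2)] drawn_subset[OF w(3)]
    by blast
  \<comment> \<open>Every vertex is on the boundary of the outer face, so any inner vertex of each
    path can be the witness; the head is taken.\<close>
  note i1 = inner_vertex[OF w(1) d(1) hd_in_set[OF ne(1)], folded c1(4)]
  note i2 = inner_vertex[OF w(2) d(2) hd_in_set[OF ne(2)], folded c2(4)]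
  note i3 = inner_vertex[OF w(3) d(3) hd_in_set[OF ne(3)], folded c3(4)]
  show False
    by (rule no_theta_on_outer_face[OF c1(1) c2(1) c3(1) c1(2,3) c2(2,3) c3(2,3) m s i1 i2 i3])
qed

text \<open>The chord is the middle arc of a theta curve; inner vertices of the other two paths are
  the points approached by the outer face.\<close>

lemma chord_inside:
  assumes w: "walk E (a # P @ [b])" "walk E (a # Q @ [b])" "{a, b} \<in> E"
    and ne: "P \<noteq> []" "Q \<noteq> []" and dis: "distinct (a # b # P @ Q)"
  shows "drawn [a, b] - {p a, p b} \<subseteq> inside (drawn (a # P @ [b]) \<union> drawn (a # Q @ [b]))"
proof -
  have d: "distinct (a # P @ [b])" "distinct (a # Q @ [b])" using dis by auto
  obtain c1 where c1: "arc c1" "pathstart c1 = p a" "pathfinish c1 = p b" "path_image c1 = drawn (a # P @ [b])"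
    using path_arc[OF w(1) d(1)] by blast
  obtain c2 where c2: "arc c2" "pathstart c2 = p a" "pathfinish c2 = p b" "path_image c2 = drawn (a # Q @ [b])"
    using path_arc[OF w(2) d(2)] by blast
  obtain m where m: "arc m" "pathstart m = p a" "pathfinish m = p b" "path_image m = drawn (a # [] @ [b])"
    using path_arc[of a "[]" b] w(3) d by auto
  have wm: "walk E (a # [] @ [b])" using w(3) by simp
  have i: "path_image c1 \<inter> path_image c2 = {p a, p b}" "path_image c1 \<inter> path_image m = {p a, p b}"
    "path_image c2 \<inter> path_image m = {p a, p b}"
    unfolding c1(4) c2(4) m(4)
    using parallel_paths_Int[OF w(1,2) ne(1)] parallel_paths_Int[OF w(1) wm ne(1)]
      parallel_paths_Int[OF w(2) wm ne(2)] dis by simp_all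
  have s: "path_image c1 \<union> path_image c2 \<union> path_image m \<subseteq> D"
    unfolding c1(4) c2(4) m(4) using drawn_subset[OF w(1)] drawn_subset[OF w(2)] drawn_subset[OF wm]
    by blast
  note i1 = inner_vertex[OF w(1) d(1) hd_in_set[OF ne(1)], folded c1(4)]
  note i2 = inner_vertex[OF w(2) d(2) hd_in_set[OF ne(2)], folded c2(4)]
  show ?thesis
    using theta_middle_inside[OF c1(1) c2(1) m(1) c1(2,3) c2(2,3) m(2,3) i s i1 i2] c1(4) c2(4) m(4)
    by simp
qed

lemma drawing_no_crossing: "no_crossing E"
  unfolding no_crossing_def
proof (intro notI, elim exE conjE)
  fix a P b Q c R d S
  assume dis: "distinct (a # P @ b # Q @ c # R @ d # S)"
    and w: "walk E (a # P @ b # Q @ c # R @ d # S @ [a])" and ac: "{a, c} \<in> E" and bd: "{b, d} \<in> E"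
  \<comment> \<open>The cycle is read twice. Cut at \<open>a\<close> and \<open>c\<close>, it
    supplies the closed curve split by the chord \<open>{a, c}\<close>; cut at \<open>b\<close> and
    \<open>d\<close>, it shows that the chord \<open>{b, d}\<close> runs inside this same
    curve.\<close>
  let ?P = "P @ b # Q" and ?Q = "rev S @ d # rev R"
  let ?P' = "Q @ c # R" and ?Q' = "rev P @ a # rev S"
  note split = iffD1[OF walk_append] and join = iffD2[OF walk_append, OF conjI]
  have P: "walk E (a # P @ [b])" and bw: "walk E (b # Q @ c # R @ d # S @ [a])"
    using split[of E "a # P" b "Q @ c # R @ d # S @ [a]"] w by simp_all
  have Q: "walk E (b # Q @ [c])" and cw: "walk E (c # R @ d # S @ [a])"
    using split[of E "b # Q" c "R @ d # S @ [a]"] bw by simp_all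
  have R: "walk E (c # R @ [d])" and S: "walk E (d # S @ [a])"
    using split[of E "c # R" d "S @ [a]"] cw by simp_all
  have P': "walk E (b # rev P @ [a])" using P walk_rev[of E "a # P @ [b]"] by simp
  have R': "walk E (d # rev R @ [c])" using R walk_rev[of E "c # R @ [d]"] by simp
  have S': "walk E (a # rev S @ [d])" using S walk_rev[of E "d # S @ [a]"] by simp
  have w1: "walk E (a # ?P @ [c])" using join[of E "a # P" b "Q @ [c]"] P Q by simp
  have w2: "walk E (a # ?Q @ [c])" using join[of E "a # rev S" d "rev R @ [c]"] S' R' by simp
  have w1': "walk E (b # ?P' @ [d])" using join[of E "b # Q" c "R @ [d]"] Q R by simp
  have w2': "walk E (b # ?Q' @ [d])" using join[of E "b # rev P" a "rev S @ [d]"] P' S' by simp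
  have pe: "path_edges (a # ?P @ [c]) \<union> path_edges (a # ?Q @ [c])
    = path_edges (b # ?P' @ [d]) \<union> path_edges (b # ?Q' @ [d])"
  proof -
    have 1: "path_edges (a # ?P @ [c]) = path_edges (a # P @ [b]) \<union> path_edges (b # Q @ [c])"
      using path_edges_append[of "a # P" b "Q @ [c]"] by simp
    have 2: "path_edges (a # ?Q @ [c]) = path_edges (rev (d # S @ [a])) \<union> path_edges (rev (c # R @ [d]))"
      using path_edges_append[of "a # rev S" d "rev R @ [c]"] by simp
    have 3: "path_edges (b # ?P' @ [d]) = path_edges (b # Q @ [c]) \<union> path_edges (c # R @ [d])"
      using path_edges_append[of "b # Q" c "R @ [d]"] by simp
    have 4: "path_edges (b # ?Q' @ [d]) = path_edges (rev (a # P @ [b])) \<union> path_edges (rev (d # S @ [a]))"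
      using path_edges_append[of "b # rev P" a "rev S @ [d]"] by simp
    show ?thesis unfolding 1 2 3 4 path_edges_rev by blast
  qed
  then have same: "drawn (a # ?P @ [c]) \<union> drawn (a # ?Q @ [c]) = drawn (b # ?P' @ [d]) \<union> drawn (b # ?Q' @ [d])"
    unfolding drawn_def by (simp only: UN_Un[symmetric])
  have dbd: "distinct (b # d # ?P' @ ?Q')"
    using dis by (simp add: Int_Un_distrib Int_Un_distrib2 Int_commute) blast
  have e_in: "drawn [b, d] - {p b, p d} \<subseteq> inside (drawn (a # ?P @ [c]) \<union> drawn (a # ?Q @ [c]))"
    unfolding same by (rule chord_inside[OF w1' w2' bd _ _ dbd]) simp_all
  have d: "distinct (a # ?P @ [c])" "distinct (a # ?Q @ [c])" "distinct (a # [] @ [c])" "distinct (b # [] @ [d])"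
    using dis by (simp; blast)+
  have wm: "walk E (a # [] @ [c])" "walk E (b # [] @ [d])" using ac bd by auto
  obtain c1 where c1: "arc c1" "pathstart c1 = p a" "pathfinish c1 = p c" "path_image c1 = drawn (a # ?P @ [c])"
    using path_arc[OF w1 d(1)] by blast
  obtain c3 where c3: "arc c3" "pathstart c3 = p a" "pathfinish c3 = p c" "path_image c3 = drawn (a # ?Q @ [c])"
    using path_arc[OF w2 d(2)] by blast
  obtain m where m: "arc m" "pathstart m = p a" "pathfinish m = p c" "path_image m = drawn (a # [] @ [c])"
    using path_arc[OF wm(1) d(3)] by blast
  obtain e where e: "arc e" "pathstart e = p b" "pathfinish e = p d" "path_image e = drawn (b # [] @ [d])"
    using path_arc[OF wm(2) d(4)] by blast
  have i: "path_image c1 \<inter> path_image c3 = {p a, p c}" "path_image c1 \<inter> path_image m = {p a, p c}"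
    "path_image c3 \<inter> path_image m = {p a, p c}"
    unfolding c1(4) c3(4) m(4)
    by (rule parallel_paths_Int[OF w1 w2] parallel_paths_Int[OF w1 wm(1)] parallel_paths_Int[OF w2 wm(1)];
        use dis in simp; blast)+
  have em: "path_image e \<inter> path_image m = {}"
    unfolding e(4) m(4)
    by (subst drawn_Int[OF wm(2,1)]) (use dis in \<open>auto simp: doubleton_eq_iff\<close>)
  have s: "path_image c1 \<union> path_image c3 \<union> path_image m \<subseteq> D"
    unfolding c1(4) c3(4) m(4) using drawn_subset[OF w1] drawn_subset[OF w2] drawn_subset[OF wm(1)] by blast
  have "b \<in> set ?P" "d \<in> set ?Q" by simp_all
  note i1 = inner_vertex[OF w1 d(1) this(1), folded c1(4)] and i3 = inner_vertex[OF w2 d(2) this(2), folded c3(4)]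
  have e_in': "path_image e - {p b, p d} \<subseteq> inside (path_image c1 \<union> path_image c3)"
    using e_in unfolding e(4) c1(4) c3(4) by simp
  show False
    by (rule no_crossing_on_outer_face[OF c1(1) c3(1) m(1) e(1) c1(2,3) c3(2,3) m(2,3) e(2,3) i em s i1 i3 e_in'])
qed

end

lemma outerplanar_excluded:
  assumes "finite_simple_graph V E" "outerplanar V E"
  shows "no_theta E" "no_crossing E"
proof -
  obtain p g where "drawing V E p g" using assms by (auto simp: outerplanar_def drawing_def)
  then show "no_theta E" "no_crossing E" using drawing.drawing_no_theta drawing.drawing_no_crossing by blast+
qed

section \<open>End blocks\<close>

definition is_cycle :: "'a set set \<Rightarrow> 'a list \<Rightarrow> bool" where
  "is_cycle E c \<longleftrightarrow> distinct c \<and> 3 \<le> length c \<and> walk E c \<and> {last c, hd c} \<in> E"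

lemma cycle_rotate:
  assumes "is_cycle E (xs @ ys)"
  shows "is_cycle E (ys @ xs)"
proof (cases "xs = [] \<or> ys = []")
  case False
  then show ?thesis using assms
    by (auto simp: is_cycle_def successively_append_iff)
qed (use assms in auto)

lemma cycle_closed_walk: "is_cycle E (a # T) \<Longrightarrow> walk E (a # T @ [a])"
  using successively_append_iff[of _ "a # T" "[a]"] by (auto simp: is_cycle_def)

lemma no_thetaD:
  assumes "no_theta E" "P \<noteq> []" "Q \<noteq> []" "R \<noteq> []" "distinct (a # b # P @ Q @ R)"
    "walk E (a # P @ [b])" "walk E (a # Q @ [b])" "walk E (a # R @ [b])"
  shows False
  using assms unfolding no_theta_def by blast

text \<open>Two different attachments split \<open>c\<close> into two paths, which form an excluded
  theta with the ear \<open>Q\<close>. The exception is a part of \<open>c\<close> that is a single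
  edge; there the ear can replace the edge, giving a longer cycle in \<open>W\<close>.\<close>

lemma ear_attachments_eq:
  assumes "no_theta E" and c: "is_cycle E c" "set c \<subseteq> W"
    and longest: "\<And>c'. is_cycle E c' \<Longrightarrow> set c' \<subseteq> W \<Longrightarrow> length c' \<le> length c"
    and Q: "walk E Q" "distinct Q" "Q \<noteq> []" "set Q \<subseteq> W - set c"
    and t: "{t, hd Q} \<in> E" "{last Q, t'} \<in> E" "t \<in> set c" "t' \<in> set c"
  shows "t = t'"
proof (rule ccontr)
  assume "t \<noteq> t'"
  obtain X Y where XY: "c = X @ t # Y" using t(3) split_list by metis
  then have "t' \<in> set (Y @ X)" using t \<open>t \<noteq> t'\<close> by auto
  then obtain A B where AB: "Y @ X = A @ t' # B" using split_list by metis
  have c1: "is_cycle E (t # A @ t' # B)"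
    using cycle_rotate[of E X "t # Y"] c(1) XY AB by simp
  have "set (t # A @ t' # B) = set (t # Y @ X)" "length (t # A @ t' # B) = length (t # Y @ X)"
    using AB by simp_all
  then have s1: "set (t # A @ t' # B) = set c" and l1: "length (t # A @ t' # B) = length c"
    using XY by auto
  have w: "walk E (t # A @ [t'])" "walk E (t' # B)" "{last (t' # B), t} \<in> E"
    and dis: "distinct (t # A @ t' # B)"
    using c1 by (auto simp: is_cycle_def successively_append_iff successively_Cons hd_append split: if_splits)
  have sQ: "set Q \<inter> set (t # A @ t' # B) = {}" "set Q \<subseteq> W" using Q s1 by auto
  have wQ: "walk E (t # Q @ [t'])" using Q(1,3) t(1,2)
    by (auto simp: successively_append_iff successively_Cons)
  consider "A = []" | "B = []" | "A \<noteq> []" "B \<noteq> []" by blast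
  then show False
  proof cases
    case 1
    have "walk E (t # Q @ t' # B)" using wQ w(2) walk_append[of E "t # Q" t' B] by simp
    then have "is_cycle E (t # Q @ t' # B)"
      using 1 w(3) dis Q sQ by (auto simp: is_cycle_def Suc_le_eq)
    moreover have "set (t # Q @ t' # B) \<subseteq> W" using s1 sQ c(2) by auto
    ultimately have "length (t # Q @ t' # B) \<le> length c" using longest by blast
    then show False using l1 1 Q(3) by (cases Q) auto
  next
    case 2
    have "walk E (rev (t # Q @ [t']))" using wQ by (simp only: walk_rev)
    then have "walk E (t' # rev Q)" using successively_append_iff[of _ "t' # rev Q" "[t]"] by simp
    then have "walk E (t # A @ t' # rev Q)" using w(1) walk_append[of E "t # A" t' "rev Q"] by simp
    moreover have "last (t # A @ t' # rev Q) = hd Q" using Q(3) by (simp add: last_rev)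
    ultimately have "is_cycle E (t # A @ t' # rev Q)"
      using 2 dis Q sQ t by (auto simp: is_cycle_def insert_commute Suc_le_eq)
    moreover have "set (t # A @ t' # rev Q) \<subseteq> W" using s1 sQ c(2) by auto
    ultimately have "length (t # A @ t' # rev Q) \<le> length c" using longest by blast
    then show False using l1 2 Q(3) by (cases Q) auto
  next
    case 3
    have "walk E ((t' # B) @ [t])" using w(2,3) successively_append_iff[of _ "t' # B" "[t]"] by auto
    then have "walk E (rev ((t' # B) @ [t]))" by (simp only: walk_rev)
    then have wB: "walk E (t # rev B @ [t'])" by simp
    have "distinct (t # t' # A @ Q @ rev B)" using dis Q sQ by auto
    then show False using no_thetaD[OF assms(1), of A Q "rev B" t t'] 3 Q(3) w(1) wQ wB by simp
  qed
qed

section \<open>Reachability within a vertex set\<close>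

definition inner_adj :: "'a set set \<Rightarrow> 'a set \<Rightarrow> ('a \<times> 'a) set" where
  "inner_adj E A = {(x, y). {x, y} \<in> E \<and> x \<in> A \<and> y \<in> A}"

lemma inner_adj_rtrancl_sym: "(x, y) \<in> (inner_adj E A)\<^sup>* \<Longrightarrow> (y, x) \<in> (inner_adj E A)\<^sup>*"
proof -
  have "sym (inner_adj E A)" by (auto simp: sym_def inner_adj_def insert_commute)
  then show "(x, y) \<in> (inner_adj E A)\<^sup>* \<Longrightarrow> (y, x) \<in> (inner_adj E A)\<^sup>*"
    using sym_rtrancl symD by metis
qed

lemma inner_adj_rtrancl_in: "(x, y) \<in> (inner_adj E A)\<^sup>* \<Longrightarrow> x \<in> A \<Longrightarrow> y \<in> A"
  by (induction rule: rtrancl_induct) (auto simp: inner_adj_def)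

lemma inner_adj_path:
  assumes "(x, y) \<in> (inner_adj E A)\<^sup>*" "x \<in> A"
  shows "\<exists>Q. walk E Q \<and> distinct Q \<and> Q \<noteq> [] \<and> hd Q = x \<and> last Q = y \<and> set Q \<subseteq> A"
  using assms
proof (induction rule: rtrancl_induct)
  case base
  then show ?case by (intro exI[of _ "[x]"]) auto
next
  case (step y z)
  then obtain Q where Q: "walk E Q" "distinct Q" "Q \<noteq> []" "hd Q = x" "last Q = y" "set Q \<subseteq> A" by blast
  have yz: "{y, z} \<in> E" "z \<in> A" using step(2) by (auto simp: inner_adj_def)
  show ?case
  proof (cases "z \<in> set Q")
    case True
    then obtain X Y where XY: "Q = X @ z # Y" using split_list by metis
    have "walk E (X @ [z])" using Q(1) XY by (auto simp: successively_append_iff)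
    moreover have "hd (X @ [z]) = x" using Q(4) XY by (cases X) auto
    ultimately show ?thesis using Q XY by (intro exI[of _ "X @ [z]"]) auto
  next
    case False
    then show ?thesis using Q yz by (intro exI[of _ "Q @ [z]"]) (auto simp: successively_append_iff)
  qed
qed

lemma longest_exists:
  assumes "P xs" "\<forall>ys. P ys \<longrightarrow> length ys \<le> n"
  shows "\<exists>zs. P zs \<and> (\<forall>ys. P ys \<longrightarrow> length ys \<le> length zs)"
  using ex_has_greatest_nat[of P xs length "Suc n"] assms by (simp add: less_Suc_eq_le)

text \<open>Only \<open>s\<close> may have neighbours outside \<open>W\<close> or fewer than two
  neighbours. A longest path in \<open>W\<close> has an end other than \<open>s\<close>; by
  maximality all neighbours of this end lie on the path, and one that is not the next vertex closes
  a cycle.\<close>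

lemma cycle_exists:
  assumes fin: "finite W" and ne: "W - {s} \<noteq> {}" and loops: "\<And>e. e \<in> E \<Longrightarrow> card e = 2"
    and closed: "\<And>v u. v \<in> W - {s} \<Longrightarrow> {v, u} \<in> E \<Longrightarrow> u \<in> W"
    and deg: "\<And>v. v \<in> W - {s} \<Longrightarrow> \<exists>u u'. u \<noteq> u' \<and> {v, u} \<in> E \<and> {v, u'} \<in> E"
  shows "\<exists>c. is_cycle E c \<and> set c \<subseteq> W"
proof -
  let ?P = "\<lambda>P. walk E P \<and> distinct P \<and> set P \<subseteq> W"
  obtain v u where vu: "v \<in> W - {s}" "{v, u} \<in> E" using ne deg by blast
  have "u \<in> W" using closed[OF vu] .
  moreover have "v \<noteq> u" using loops[OF vu(2)] by auto
  ultimately have base: "?P [v, u]" using vu by simp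
  have "\<forall>P. ?P P \<longrightarrow> length P \<le> card W"
    using fin by (metis card_mono distinct_card)
  from longest_exists[of ?P, OF base this]
  obtain P where P: "?P P" and max: "\<And>P'. ?P P' \<Longrightarrow> length P' \<le> length P" by metis
  have "2 \<le> length P" using max[OF base] by simp
  then have "hd P \<noteq> last P" using P by (cases P) (auto simp: Suc_le_eq)
  then obtain P0 where P0: "?P P0" "length P0 = length P" "hd P0 \<noteq> s"
  proof (cases "hd P = s")
    case True
    have "?P (rev P)" using P walk_rev[of E P] by simp
    then show ?thesis using that[of "rev P"] True \<open>hd P \<noteq> last P\<close> by (simp add: hd_rev)
  next
    case False
    then show ?thesis using that[of P] P by blast
  qed
  obtain x P' where xP: "P0 = x # P'" using P0 \<open>2 \<le> length P\<close> by (cases P0) auto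
  have x: "x \<in> W - {s}" using P0 xP by auto
  have "P' \<noteq> []" using xP P0(2) \<open>2 \<le> length P\<close> by auto
  have nb: "z \<in> set P'" if "{x, z} \<in> E" for z
  proof (rule ccontr)
    assume z: "z \<notin> set P'"
    have "x \<noteq> z" using loops[OF that] by auto
    moreover have "z \<in> W" using closed[OF x that] .
    ultimately have "?P (z # P0)" using z that P0(1) xP by (simp add: insert_commute)
    then show False using max[of "z # P0"] P0(2) by simp
  qed
  obtain z where z: "{x, z} \<in> E" "z \<noteq> hd P'" using deg[OF x] by metis
  then obtain A B where AB: "P' = A @ z # B" using nb split_list by metis
  then have "A \<noteq> []" using z by auto
  have "walk E (x # A @ [z])" using P0(1) xP AB walk_append[of E "x # A" z B] by simp
  then have "is_cycle E (x # A @ [z])"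
    using P0 xP AB z \<open>A \<noteq> []\<close> by (auto simp: is_cycle_def insert_commute Suc_le_eq)
  then show ?thesis using P0 xP AB by (intro exI[of _ "x # A @ [z]"]) auto
qed

text \<open>A longest cycle \<open>c\<close> in \<open>W\<close>: each component of \<open>W - c\<close> has at most one neighbour on \<open>c\<close>, so
  if a component hangs on a vertex other than the one leading to \<open>s\<close>, it is a smaller instance.\<close>

lemma end_block_cycle:
  assumes "finite W" "W - {s} \<noteq> {}" "no_theta E" and loops: "\<And>e. e \<in> E \<Longrightarrow> card e = 2"
    and "\<And>v u. v \<in> W - {s} \<Longrightarrow> {v, u} \<in> E \<Longrightarrow> u \<in> W"
    and "\<And>v. v \<in> W - {s} \<Longrightarrow> \<exists>u u'. u \<noteq> u' \<and> {v, u} \<in> E \<and> {v, u'} \<in> E"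
  shows "\<exists>c. is_cycle E c \<and> (\<forall>v\<in>set (tl c). \<forall>u. {v, u} \<in> E \<longrightarrow> u \<in> set c)"
  using assms(1,2,5,6)
proof (induction "card W" arbitrary: W s rule: less_induct)
  case less
  note closed = less.prems(3) and deg = less.prems(4)
  let ?C = "\<lambda>c. is_cycle E c \<and> set c \<subseteq> W"
  have "\<exists>c. ?C c" by (rule cycle_exists[of W s E]) (fact loops less.prems)+
  then obtain c0 where c0: "?C c0" by metis
  have "\<forall>c. ?C c \<longrightarrow> length c \<le> card W"
    using less.prems(1) by (metis card_mono distinct_card is_cycle_def)
  from longest_exists[of ?C, OF c0 this]
  obtain c where c: "is_cycle E c" "set c \<subseteq> W"
    and longest: "\<And>c'. is_cycle E c' \<Longrightarrow> set c' \<subseteq> W \<Longrightarrow> length c' \<le> length c" by metis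
  let ?A = "W - set c"
  define K where "K y = {z. (y, z) \<in> (inner_adj E ?A)\<^sup>*}" for y
  have KA: "K y \<subseteq> ?A" if "y \<in> ?A" for y
  proof
    fix z assume "z \<in> K y"
    then have "(y, z) \<in> (inner_adj E ?A)\<^sup>*" unfolding K_def by (rule CollectD)
    then show "z \<in> ?A" using that by (rule inner_adj_rtrancl_in)
  qed
  have uniq: "t = t'" if "y \<in> ?A" "z \<in> K y" "t \<in> set c" "t' \<in> set c" "{t, y} \<in> E" "{t', z} \<in> E" for y z t t'
  proof -
    have "(y, z) \<in> (inner_adj E ?A)\<^sup>*" using that(2) unfolding K_def by (rule CollectD)
    from inner_adj_path[OF this that(1)]
    obtain Q where Q: "walk E Q" "distinct Q" "Q \<noteq> []" "hd Q = y" "last Q = z" "set Q \<subseteq> ?A" by metis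
    have "{t, hd Q} \<in> E" "{last Q, t'} \<in> E" using Q(4,5) that(5,6) by (simp_all add: insert_commute)
    from ear_attachments_eq[OF assms(3) c longest Q(1,2,3,6) this that(3,4)] show "t = t'" by metis
  qed
  \<comment> \<open>The vertex \<open>r\<close> is the one on \<open>c\<close> that leads to
    \<open>s\<close>: \<open>s\<close> itself if it lies on \<open>c\<close>, otherwise the
    attachment of the component containing \<open>s\<close>, and an arbitrary vertex if that
    component has no attachment. Uniqueness of attachments keeps \<open>s\<close> out of the
    components at all other vertices of \<open>c\<close>.\<close>
  have "\<exists>r\<in>set c. (s \<in> set c \<longrightarrow> r = s) \<and>
      (\<forall>t\<in>set c - {r}. \<forall>y\<in>?A. {t, y} \<in> E \<longrightarrow> s \<notin> K y)"
  proof (cases "\<exists>t\<in>set c. \<exists>y\<in>?A. {t, y} \<in> E \<and> s \<in> K y")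
    case True
    then obtain r y where r: "r \<in> set c" "y \<in> ?A" "{r, y} \<in> E" "s \<in> K y" by blast
    have "t = r" if "t \<in> set c" "z \<in> ?A" "{t, z} \<in> E" "s \<in> K z" for t z
    proof -
      have "y \<in> K z" using r(4) that(4) inner_adj_rtrancl_sym unfolding K_def
        by (metis (no_types, lifting) mem_Collect_eq rtrancl_trans)
      then show ?thesis using uniq[of z y t r] that r by blast
    qed
    then show ?thesis using r KA by blast
  next
    case False
    have "hd c \<in> set c" using c(1) by (cases c) (auto simp: is_cycle_def)
    then show ?thesis using False by (cases "s \<in> set c") blast+
  qed
  then obtain r where r: "r \<in> set c" "s \<in> set c \<Longrightarrow> r = s"
    and rK: "\<And>t y. t \<in> set c - {r} \<Longrightarrow> y \<in> ?A \<Longrightarrow> {t, y} \<in> E \<Longrightarrow> s \<notin> K y" by blast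
  show ?case
  proof (cases "\<exists>t\<in>set c - {r}. \<exists>y\<in>?A. {t, y} \<in> E")
    case True
    then obtain t y where t: "t \<in> set c - {r}" "y \<in> ?A" "{t, y} \<in> E" by blast
    \<comment> \<open>The component with its attachment \<open>t\<close> is an instance in which
      \<open>t\<close> takes the role of \<open>s\<close>. It lacks \<open>r\<close>, so it is
      smaller, and its vertices other than \<open>t\<close> differ from \<open>s\<close>, so they
      inherit the hypotheses.\<close>
    let ?W = "insert t (K y)"
    have sub: "?W \<subseteq> W" using KA[OF t(2)] t(1) c(2) by auto
    have yK: "y \<in> K y" by (simp add: K_def)
    have "r \<notin> ?W" "r \<in> W" using KA[OF t(2)] t(1) r(1) c(2) by auto
    then have card: "card ?W < card W" using sub less.prems(1) by (intro psubset_card_mono) auto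
    have K_ok: "v \<in> W - {s}" if "v \<in> ?W - {t}" for v
      using that rK[OF t] KA[OF t(2)] by auto
    have cl: "u \<in> ?W" if v: "v \<in> ?W - {t}" and e: "{v, u} \<in> E" for v u
    proof (cases "u \<in> set c")
      case True
      have "t = u" using uniq[OF t(2) _ _ True t(3)] v e t(1) by (auto simp: insert_commute)
      then show ?thesis by simp
    next
      case False
      have vA: "v \<in> ?A" "v \<in> K y" using v KA[OF t(2)] by auto
      have "u \<in> W" using closed[OF K_ok[OF v] e] .
      then have "(v, u) \<in> inner_adj E ?A" using vA False e by (simp add: inner_adj_def)
      then show ?thesis using vA(2) unfolding K_def by (simp add: rtrancl.rtrancl_into_rtrancl)
    qed
    show ?thesis
      by (rule less.hyps[of ?W t]) (use card cl deg K_ok sub less.prems(1) yK t finite_subset in auto)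
  next
    case False
    obtain X Y where XY: "c = X @ r # Y" using r(1) split_list by metis
    \<comment> \<open>Nothing hangs on the cycle except possibly at \<open>r\<close>, which moves to
      the head, the position exempted in the conclusion.\<close>
    let ?c = "(r # Y) @ X"
    have cyc: "is_cycle E ?c" by (rule cycle_rotate) (use c(1) XY in simp)
    have set_eq: "set ?c = set c" using XY by auto
    have "u \<in> set ?c" if v: "v \<in> set (tl ?c)" and e: "{v, u} \<in> E" for v u
    proof -
      have "v \<in> set c" "v \<noteq> r" using v cyc XY by (auto simp: is_cycle_def)
      then have "v \<in> W - {s}" using c(2) r(2) by auto
      then have "u \<in> W" using closed e by blast
      then show ?thesis using False \<open>v \<in> set c\<close> \<open>v \<noteq> r\<close> e set_eq by auto
    qed
    then show ?thesis using cyc by blast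
  qed
qed

section \<open>Unavoidable configurations\<close>

definition nbrs_in :: "'a set set \<Rightarrow> 'a \<Rightarrow> 'a set \<Rightarrow> bool" where
  "nbrs_in E u S \<longleftrightarrow> (\<forall>z. {u, z} \<in> E \<longrightarrow> z \<in> S)"

lemma drop_nth_split:
  assumes "i < j" "j < length c"
  shows "\<exists>P. drop i c = c ! i # P @ drop j c"
proof -
  have "drop (Suc i) c = take (j - Suc i) (drop (Suc i) c) @ drop j c"
    using append_take_drop_id[of "j - Suc i" "drop (Suc i) c"] assms by simp
  then show ?thesis using Cons_nth_drop_Suc[of i c] assms by (metis less_trans)
qed

lemma cycle_no_crossing:
  assumes "is_cycle E c" "no_crossing E" "i < j" "j < k" "k < l" "l < length c"
    and "{c ! i, c ! k} \<in> E" "{c ! j, c ! l} \<in> E"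
  shows False
proof -
  obtain P Q R where P: "drop i c = c ! i # P @ drop j c" and Q: "drop j c = c ! j # Q @ drop k c"
    and R: "drop k c = c ! k # R @ drop l c"
    using drop_nth_split[of i j c] drop_nth_split[of j k c] drop_nth_split[of k l c] assms(3-6) by auto
  have S: "drop l c = c ! l # drop (Suc l) c" using assms(6) by (simp add: Cons_nth_drop_Suc)
  have "drop i c = c ! i # P @ c ! j # Q @ c ! k # R @ c ! l # drop (Suc l) c"
    using P Q R S by simp
  moreover have cyc: "is_cycle E (drop i c @ take i c)"
    by (rule cycle_rotate) (use assms(1) in simp)
  ultimately have cyc: "is_cycle E (c ! i # P @ c ! j # Q @ c ! k # R @ c ! l # drop (Suc l) c @ take i c)"
    by simp
  have "walk E (c ! i # P @ c ! j # Q @ c ! k # R @ c ! l # (drop (Suc l) c @ take i c) @ [c ! i])"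
    using cycle_closed_walk[OF cyc] by simp
  moreover have "distinct (c ! i # P @ c ! j # Q @ c ! k # R @ c ! l # (drop (Suc l) c @ take i c))"
    using cyc by (simp add: is_cycle_def)
  ultimately show False using assms(2,7,8) unfolding no_crossing_def by blast
qed

text \<open>The path \<open>x a b y\<close> may close up to a triangle: \<open>x = y\<close> is allowed.\<close>

definition config1 :: "'a set set \<Rightarrow> 'a \<Rightarrow> 'a \<Rightarrow> 'a \<Rightarrow> 'a \<Rightarrow> bool" where
  "config1 E x a b y \<longleftrightarrow> distinct [a, b, x] \<and> distinct [a, b, y] \<and>
     {{x, a}, {a, b}, {b, y}} \<subseteq> E \<and> nbrs_in E a {x, b} \<and> nbrs_in E b {a, y}"

definition config2 :: "'a set set \<Rightarrow> 'a \<Rightarrow> 'a \<Rightarrow> 'a \<Rightarrow> 'a \<Rightarrow> bool" where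
  "config2 E u v w x \<longleftrightarrow> distinct [u, v, w, x] \<and> {{u, w}, {u, v}, {v, w}, {v, x}} \<subseteq> E \<and>
     nbrs_in E u {v, w} \<and> nbrs_in E v {u, w, x}"

definition config3 :: "'a set set \<Rightarrow> 'a \<Rightarrow> 'a \<Rightarrow> 'a \<Rightarrow> 'a \<Rightarrow> 'a \<Rightarrow> bool" where
  "config3 E u v1 v2 x y \<longleftrightarrow> distinct [u, v1, v2, x, y] \<and>
     {{u, v1}, {u, v2}, {v1, x}, {v2, y}, {u, x}, {u, y}} \<subseteq> E \<and>
     nbrs_in E u {v1, v2, x, y} \<and> nbrs_in E v1 {u, x} \<and> nbrs_in E v2 {u, y}"

definition has_config :: "'a set set \<Rightarrow> bool" where
  "has_config E \<longleftrightarrow> (\<exists>x a b y. config1 E x a b y) \<or> (\<exists>u v w x. config2 E u v w x) \<or>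
     (\<exists>u v1 v2 x y. config3 E u v1 v2 x y)"

text \<open>Take a shortest chord \<open>c ! i \<dots> c ! j\<close> with at least two vertices strictly between: all chords
  below it cut off a single vertex, so the neighbourhoods of \<open>c ! (i + 1)\<close> and \<open>c ! (i + 2)\<close> are known.\<close>

lemma cycle_has_config:
  assumes c: "is_cycle E c" and cr: "no_crossing E" and loops: "\<And>e. e \<in> E \<Longrightarrow> card e = 2"
    and closed: "\<And>v u. v \<in> set (tl c) \<Longrightarrow> {v, u} \<in> E \<Longrightarrow> u \<in> set c"
  shows "has_config E"
proof -
  define n where "n = length c"
  define adj where "adj i j \<longleftrightarrow> {c ! i, c ! j} \<in> E" for i j
  have n: "3 \<le> n" and dis: "distinct c" using c by (auto simp: n_def is_cycle_def)
  have sym: "adj i j \<longleftrightarrow> adj j i" for i j by (simp add: adj_def insert_commute)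
  have eq: "c ! i = c ! j \<longleftrightarrow> i = j" if "i < n" "j < n" for i j
    using that dis by (simp add: n_def nth_eq_iff_index_eq)
  have irrefl: "\<not> adj i i" for i using loops[of "{c ! i, c ! i}"] by (auto simp: adj_def)
  have step: "adj i (Suc i)" if "Suc i < n" for i
    using c that successively_nth[of "\<lambda>u v. {u, v} \<in> E" c i] by (simp add: is_cycle_def adj_def n_def)
  have close: "adj 0 (n - 1)"
  proof -
    have "c \<noteq> []" using n by (auto simp: n_def)
    then show ?thesis using c by (simp add: is_cycle_def adj_def n_def last_conv_nth hd_conv_nth insert_commute)
  qed
  have noncross: "\<not> (adj i k \<and> adj j l)" if "i < j" "j < k" "k < l" "l < n" for i j k l
    using cycle_no_crossing[OF c cr, of i j k l] that by (auto simp: adj_def n_def)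
  have nb: "\<exists>l<n. u = c ! l \<and> adj k l" if "0 < k" "k < n" "{c ! k, u} \<in> E" for k u
  proof -
    have "c ! k \<in> set (tl c)" using that nth_tl[of "k - 1" c] nth_mem[of "k - 1" "tl c"] by (simp add: n_def)
    then have "u \<in> set c" using closed that(3) by blast
    then show ?thesis using that(3) by (auto simp: in_set_conv_nth n_def adj_def)
  qed
  show ?thesis
  proof (cases "n = 3")
    case True
    have "adj 0 1" "adj 1 2" "adj 0 2" using step[of 0] step[of 1] close True by (simp_all add: numeral_2_eq_2)
    moreover have "u \<in> {c ! 0, c ! 2}" if e: "{c ! 1, u} \<in> E" for u
    proof -
      obtain l where l: "l < n" "u = c ! l" "adj 1 l" using nb[of 1 u] e True by auto
      then have "l = 0 \<or> l = 2" using irrefl[of 1] True by (cases "l = 1") auto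
      then show ?thesis using l(2) by auto
    qed
    moreover have "u \<in> {c ! 1, c ! 0}" if e: "{c ! 2, u} \<in> E" for u
    proof -
      obtain l where l: "l < n" "u = c ! l" "adj 2 l" using nb[of 2 u] e True by auto
      then have "l = 0 \<or> l = 1" using irrefl[of 2] True by (cases "l = 2") auto
      then show ?thesis using l(2) by auto
    qed
    ultimately have "config1 E (c ! 0) (c ! 1) (c ! 2) (c ! 0)"
      using True eq by (auto simp: config1_def nbrs_in_def adj_def insert_commute)
    then show ?thesis unfolding has_config_def by blast
  next
    case False
    let ?P = "\<lambda>(i, j). i + 3 \<le> j \<and> j < n \<and> adj i j"
    \<comment> \<open>The closing edge of the cycle counts as a chord here, so a candidate exists as
      soon as the cycle has four vertices.\<close>
    have "?P (0, n - 1)" using n False close by auto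
    then obtain ij where "?P ij" "\<And>ij'. ?P ij' \<Longrightarrow> snd ij - fst ij \<le> snd ij' - fst ij'"
      using ex_has_least_nat[of ?P "(0, n - 1)" "\<lambda>(i, j). j - i"] by (auto simp: case_prod_beta)
    then obtain i j where ij: "i + 3 \<le> j" "j < n" "adj i j"
      and least: "\<And>i' j'. i' + 3 \<le> j' \<Longrightarrow> j' < n \<Longrightarrow> adj i' j' \<Longrightarrow> j - i \<le> j' - i'"
      by (cases ij) fastforce
    \<comment> \<open>Noncrossing with the chord from \<open>i\<close> to \<open>j\<close> confines
      the neighbours to this range, and minimality excludes index distance 3 or more. For
      \<open>k = 1\<close> the truncated \<open>k - 2\<close> is 0 and agrees with
      \<open>k - 1\<close>. Since \<open>i < k\<close>, the exempt head of \<open>c\<close> never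
      occurs as \<open>k\<close>.\<close>
    have inner: "k' \<in> {k - 2, k - 1, k + 1, k + 2} \<and> i \<le> k' \<and> k' \<le> j"
      if k: "i < k" "k < j" and k': "k' < n" "adj k k'" for k k'
    proof -
      have 1: "\<not> k' < i" using noncross[of k' i k j] k k' ij sym by blast
      have 2: "\<not> j < k'" using noncross[of i k j k'] k k' ij sym by blast
      have 3: "\<not> k + 3 \<le> k'" using least[of k k'] k k' 2 by auto
      have 4: "\<not> k' + 3 \<le> k" using least[of k' k] k k' 1 ij sym[of k k'] by auto
      show ?thesis using 1 2 3 4 irrefl[of k] k'(2) by (cases "k' = k") auto
    qed
    \<comment> \<open>Indices are now relative to \<open>i\<close>; \<open>w 0\<close> and
      \<open>w m\<close> are the ends of the chosen chord.\<close>
    define m where "m = j - i"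
    define w where "w k = c ! (i + k)" for k
    define B where "B k l \<longleftrightarrow> adj (i + k) (i + l)" for k l
    have m: "3 \<le> m" "\<And>k. k \<le> m \<Longrightarrow> i + k < n" using ij by (auto simp: m_def)
    have Bw: "B k l \<longleftrightarrow> {w k, w l} \<in> E" for k l by (simp add: B_def adj_def w_def)
    have Bsym: "B k l \<longleftrightarrow> B l k" for k l using sym by (simp add: B_def)
    have weq: "w k = w l \<longleftrightarrow> k = l" if "k \<le> m" "l \<le> m" for k l
      using eq[of "i + k" "i + l"] m that by (simp add: w_def)
    have Bstep: "B k (Suc k)" if "Suc k \<le> m" for k
      using step[of "i + k"] m(2)[OF that] by (simp add: B_def)
    have Bcross: "\<not> B k k'" if "B h l" "h < k" "k < l" "l < k'" "k' \<le> m" for h k l k'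
      using noncross[of "i + h" "i + k" "i + l" "i + k'"] m(2)[of k'] that by (auto simp: B_def)
    have nbI: "nbrs_in E (w k) S"
      if "0 < k" "k < m" "\<And>l. l \<le> m \<Longrightarrow> B k l \<Longrightarrow> l + 2 = k \<or> l + 1 = k \<or> l = k + 1 \<or> l = k + 2 \<Longrightarrow> w l \<in> S"
      for k S
      unfolding nbrs_in_def
    proof (intro allI impI)
      fix u assume u: "{w k, u} \<in> E"
      have ik: "i < i + k" "i + k < j" using that(1,2) by (auto simp: m_def)
      obtain k' where k': "k' < n" "u = c ! k'" "adj (i + k) k'"
        using nb[of "i + k" u] u ik ij by (auto simp: w_def)
      have "k' \<in> {i + k - 2, i + k - 1, i + k + 1, i + k + 2}" "i \<le> k'" "k' \<le> j"
        using inner[OF ik k'(1,3)] by auto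
      moreover define l where "l = k' - i"
      ultimately have "k' = i + l" "l \<le> m" "l + 2 = k \<or> l + 1 = k \<or> l = k + 1 \<or> l = k + 2 \<or> k' = i + k"
        using that(1) by (auto simp: m_def)
      then show "u \<in> S" using that(3)[of l] k' irrefl by (auto simp: w_def B_def)
    qed
    have s: "B 0 1" "B 1 2" "B 2 3" using Bstep[of 0] Bstep[of 1] Bstep[of 2] m(1)
      by (simp_all add: numeral_2_eq_2 numeral_3_eq_3)
    have s34: "B 3 4" if "4 \<le> m" using Bstep[of 3] that by (simp add: eval_nat_numeral)
    have N3: "nbrs_in E (w 3) {w 2, w 4}" if "4 \<le> m" "B 2 4" "\<not> B 3 1"
    proof (rule nbI)
      fix l assume l: "l \<le> m" "B 3 l" "l + 2 = 3 \<or> l + 1 = 3 \<or> l = 3 + 1 \<or> l = 3 + 2"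
      have "\<not> (5 \<le> m \<and> B 3 5)" using Bcross[OF that(2), of 3 5] by auto
      moreover from l(3) have "l = 1 \<or> l = 2 \<or> l = 4 \<or> l = 5" by linarith
      ultimately show "w l \<in> {w 2, w 4}" using l(1,2) that(3) by auto
    qed (use that in auto)
    have n1: "nbrs_in E (w 1) S" if "w 0 \<in> S" "w 2 \<in> S" "B 1 3 \<Longrightarrow> w 3 \<in> S" for S
    proof (rule nbI)
      fix l assume l: "l \<le> m" "B 1 l" "l + 2 = 1 \<or> l + 1 = 1 \<or> l = 1 + 1 \<or> l = 1 + 2"
      from l(3) have "l = 0 \<or> l = 2 \<or> l = 3" by linarith
      then show "w l \<in> S" using l(2) that by auto
    qed (use m in auto)
    have n2: "nbrs_in E (w 2) S"
      if "B 0 2 \<Longrightarrow> w 0 \<in> S" "w 1 \<in> S" "w 3 \<in> S" "4 \<le> m \<Longrightarrow> B 2 4 \<Longrightarrow> w 4 \<in> S" for S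
    proof (rule nbI)
      fix l assume l: "l \<le> m" "B 2 l" "l + 2 = 2 \<or> l + 1 = 2 \<or> l = 2 + 1 \<or> l = 2 + 2"
      from l(3) have "l = 0 \<or> l = 1 \<or> l = 3 \<or> l = 4" by linarith
      then show "w l \<in> S" using l(1,2) that Bsym[of 0 2] by auto
    qed (use m in auto)
    show ?thesis
    \<comment> \<open>The chords 02, 13 and 24 decide: 02 with 24 gives \<open>config3\<close>,
      exactly one of the three gives \<open>config2\<close>, none gives \<open>config1\<close>.
      Noncrossing forbids 13 beside either of the others.\<close>
    proof (cases "B 0 2")
      case True
      have a13: "\<not> B 1 3" using Bcross[OF True, of 1 3] m by auto
      have N1: "nbrs_in E (w 1) {w 2, w 0}" by (rule n1) (use a13 in auto)
      show ?thesis
      proof (cases "4 \<le> m \<and> B 2 4")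
        case True2: True
        have "nbrs_in E (w 2) {w 1, w 3, w 0, w 4}" by (rule n2) auto
        then have "config3 E (w 2) (w 1) (w 3) (w 0) (w 4)"
          using True True2 s s34 N1 N3 a13 Bsym[of 1 3]
          by (simp add: config3_def Bw insert_commute weq)
        then show ?thesis unfolding has_config_def by blast
      next
        case False
        have "nbrs_in E (w 2) {w 1, w 0, w 3}" by (rule n2) (use False in auto)
        then have "config2 E (w 1) (w 2) (w 0) (w 3)"
          using True s N1 m(1) by (simp add: config2_def Bw insert_commute weq)
        then show ?thesis unfolding has_config_def by blast
      qed
    next
      case no02: False
      show ?thesis
      proof (cases "B 1 3")
        case True
        have "\<not> B 2 4" if "4 \<le> m" using Bcross[OF True, of 2 4] that by auto
        then have N2: "nbrs_in E (w 2) {w 1, w 3}" by (intro n2) (use no02 in auto)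
        have "nbrs_in E (w 1) {w 2, w 3, w 0}" by (rule n1) auto
        then have "config2 E (w 2) (w 1) (w 3) (w 0)"
          using True s N2 m(1) by (simp add: config2_def Bw insert_commute weq)
        then show ?thesis unfolding has_config_def by blast
      next
        case no13: False
        have N1: "nbrs_in E (w 1) {w 0, w 2}" by (rule n1) (use no13 in auto)
        show ?thesis
        proof (cases "4 \<le> m \<and> B 2 4")
          case True2: True
          have "nbrs_in E (w 2) {w 3, w 4, w 1}" by (rule n2) (use no02 in auto)
          then have "config2 E (w 3) (w 2) (w 4) (w 1)"
            using True2 s s34 N3 no13 Bsym[of 1 3] by (simp add: config2_def Bw insert_commute weq)
          then show ?thesis unfolding has_config_def by blast
        next
          case False
          have "nbrs_in E (w 2) {w 1, w 3}" by (rule n2) (use no02 False in auto)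
          then have "config1 E (w 0) (w 1) (w 2) (w 3)"
            using s N1 m(1) by (simp add: config1_def Bw insert_commute weq)
          then show ?thesis unfolding has_config_def by blast
        qed
      qed
    qed
  qed
qed

lemma unavoidable_config:
  assumes fin: "finite E" and ne: "E \<noteq> {}" and loops: "\<And>e. e \<in> E \<Longrightarrow> card e = 2"
    and excl: "no_theta E" "no_crossing E"
    and deg: "\<And>u v. {u, v} \<in> E \<Longrightarrow> \<exists>w. w \<noteq> v \<and> {u, w} \<in> E"
  shows "has_config E"
proof -
  have fW: "finite (\<Union>E)" using fin loops by (metis card.infinite finite_Union zero_neq_numeral)
  have cl: "u \<in> \<Union>E" if "{v, u} \<in> E" for u v using that by auto
  have dg: "\<exists>u u'. u \<noteq> u' \<and> {v, u} \<in> E \<and> {v, u'} \<in> E" if "v \<in> \<Union>E" for v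
  proof -
    obtain e where e: "e \<in> E" "v \<in> e" using \<open>v \<in> \<Union>E\<close> by blast
    then obtain u where "e = {v, u}" using loops[OF e(1)] by (auto simp: card_2_iff)
    then show ?thesis using e deg[of v u] by metis
  qed
  \<comment> \<open>Any vertex can be the exempt \<open>s\<close>, because the set of all end
    vertices is closed under adjacency and contains no vertex of degree 1.\<close>
  obtain e where "e \<in> E" using ne by blast
  then obtain s t where st: "{s, t} \<in> E" "s \<noteq> t" using loops by (metis card_2_iff)
  then have "\<Union>E - {s} \<noteq> {}" by blast
  from end_block_cycle[OF fW this excl(1) loops] cl dg
  obtain c where c: "is_cycle E c" "\<forall>v\<in>set (tl c). \<forall>u. {v, u} \<in> E \<longrightarrow> u \<in> set c" by blast
  show ?thesis by (rule cycle_has_config[OF c(1) excl(2) loops]) (use c(2) in auto)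
qed

section \<open>Local label choices\<close>

definition far :: "nat \<Rightarrow> nat \<Rightarrow> bool" where
  "far v e \<longleftrightarrow> v + 2 \<le> e \<or> e + 2 \<le> v"

definition labels :: "nat list" where
  "labels = [0, 1, 2, 3, 4, 5, 6]"

definition free_labels :: "nat \<Rightarrow> nat list" where
  "free_labels p = filter (far p) labels"

fun sublists :: "nat \<Rightarrow> 'a list \<Rightarrow> 'a list list" where
  "sublists 0 xs = [[]]"
| "sublists (Suc k) [] = []"
| "sublists (Suc k) (x # xs) = map ((#) x) (sublists k xs) @ sublists (Suc k) xs"

text \<open>The least label sets that can remain for the further edges at a vertex labelled \<open>p\<close> once \<open>k\<close> of
  its edges are labelled.\<close>

definition lists_avoiding :: "nat \<Rightarrow> nat \<Rightarrow> nat list list" where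
  "lists_avoiding k p = sublists (length (free_labels p) - k) (free_labels p)"

text \<open>The conditional lets evaluation by rewriting stop at the first witness; the nested
  conditionals of the searches below serve the same purpose.\<close>

fun search :: "('a \<Rightarrow> bool) \<Rightarrow> 'a list \<Rightarrow> bool" where
  "search P [] = False"
| "search P (x # xs) = (if P x then True else search P xs)"

lemma search_iff: "search P xs \<longleftrightarrow> (\<exists>x\<in>set xs. P x)"
  by (induction xs) auto

lemma set_labels: "set labels = {..6}"
  by (auto simp: labels_def)

lemma set_free_labels: "set (free_labels p) = {e. e \<le> 6 \<and> far p e}"
  by (auto simp: free_labels_def set_labels)

lemma distinct_free_labels: "distinct (free_labels p)"
  by (simp add: free_labels_def labels_def)

lemma sublists_complete:
  assumes "X \<subseteq> set xs" "card X = k" "distinct xs"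
  shows "\<exists>l\<in>set (sublists k xs). set l = X"
  using assms
proof (induction k xs arbitrary: X rule: sublists.induct)
  case (1 xs)
  then have "X = {}" by (metis card_0_eq finite_set finite_subset)
  then show ?case by simp
next
  case (2 k)
  then show ?case by simp
next
  case (3 k x xs)
  have fin: "finite X" using 3(3) finite_subset by blast
  show ?case
  proof (cases "x \<in> X")
    case True
    then have "\<exists>l\<in>set (sublists k xs). set l = X - {x}" using 3 fin by (intro 3(1)) auto
    then obtain l where "l \<in> set (sublists k xs)" "set l = X - {x}" by blast
    then show ?thesis using True by (intro bexI[of _ "x # l"]) auto
  next
    case False
    then have "\<exists>l\<in>set (sublists (Suc k) xs). set l = X" using 3 by (intro 3(2)) auto
    then show ?thesis by auto
  qed
qed

lemma free_labels_length: "p \<le> 6 \<Longrightarrow> 4 \<le> length (free_labels p)"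
proof -
  assume "p \<le> 6"
  then have "p \<in> set labels" by (simp add: set_labels)
  moreover have "list_all (\<lambda>p. 4 \<le> length (free_labels p)) labels" by code_simp
  ultimately show ?thesis by (simp add: list_all_iff)
qed

text \<open>At least four labels are far from \<open>p\<close> and at most \<open>k\<close> are
  taken, so a subset of the size used in \<open>lists_avoiding\<close> fits into the rest. The set
  \<open>W\<close> prescribes labels that the list has to retain, such as those carried by the
  smaller graph; the bound on \<open>card W\<close> leaves room for them.\<close>

lemma lists_avoiding_complete:
  assumes "p \<le> 6" "finite S" "card S \<le> k" "k \<le> 3"
    and W: "W \<subseteq> {e. e \<le> 6 \<and> far p e} - S" "card W \<le> 4 - k"
  obtains l where "l \<in> set (lists_avoiding k p)" "W \<subseteq> set l"
    "set l \<subseteq> {e. e \<le> 6 \<and> far p e} - S" "l \<noteq> []"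
proof -
  let ?A = "{e. e \<le> 6 \<and> far p e} - S" and ?n = "length (free_labels p) - k"
  have len: "4 \<le> length (free_labels p)" using assms free_labels_length by blast
  have cF: "card {e. e \<le> 6 \<and> far p e} = length (free_labels p)"
    using distinct_card[OF distinct_free_labels] set_free_labels by metis
  have finA: "finite {e. e \<le> 6 \<and> far p e}" by simp
  have "card {e. e \<le> 6 \<and> far p e} - card S \<le> card ?A" by (rule diff_card_le_card_Diff[OF assms(2)])
  then have "?n \<le> card ?A" using cF assms by linarith
  then have "?n - card W \<le> card (?A - W)"
    using card_Diff_subset[OF _ W(1)] finite_subset[OF W(1)] by simp
  then obtain Y where Y: "Y \<subseteq> ?A - W" "card Y = ?n - card W" "finite Y"
    by (meson obtain_subset_with_card_n)
  have finW: "finite W" using W(1) finite_subset by fastforce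
  have "card (Y \<union> W) = ?n"
    using Y finW card_Un_disjoint[of Y W] W(2) len assms(4) by fastforce
  moreover have "Y \<union> W \<subseteq> set (free_labels p)" using Y W by (auto simp: set_free_labels)
  ultimately obtain l where l: "l \<in> set (lists_avoiding k p)" "set l = Y \<union> W"
    using sublists_complete[OF _ _ distinct_free_labels] unfolding lists_avoiding_def by blast
  moreover have "l \<noteq> []" using \<open>card (Y \<union> W) = ?n\<close> l(2) len assms(4) by auto
  ultimately show thesis using that[of l] Y W by blast
qed

text \<open>In terms of \<open>config1\<close>, \<open>p\<close> and \<open>q\<close> are the labels
  of \<open>x\<close> and \<open>y\<close>, \<open>e\<close> and \<open>g\<close> those of the outer
  edges at \<open>x\<close> and \<open>y\<close>, \<open>ab\<close> that of the middle edge, and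
  \<open>a\<close> and \<open>b\<close> those of the inner vertices. If \<open>x = y\<close> the
  outer edges meet, whence \<open>e \<noteq> g\<close>, the only difference from
  \<open>sol_path\<close>.\<close>

definition sol_triangle :: "nat \<Rightarrow> nat \<Rightarrow> nat list \<Rightarrow> nat list \<Rightarrow> bool" where
  "sol_triangle p q l m = search (\<lambda>e. search (\<lambda>g. if e \<noteq> g then
     search (\<lambda>a. if a \<noteq> p \<and> far a e then search (\<lambda>ab. if ab \<noteq> e \<and> ab \<noteq> g \<and> far a ab then
       search (\<lambda>b. b \<noteq> a \<and> b \<noteq> q \<and> far b g \<and> far b ab) labels
       else False) labels else False) labels else False) m) l"

definition sol_path :: "nat \<Rightarrow> nat \<Rightarrow> nat list \<Rightarrow> nat list \<Rightarrow> bool" where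
  "sol_path p q l m = search (\<lambda>e. search (\<lambda>g.
     search (\<lambda>a. if a \<noteq> p \<and> far a e then search (\<lambda>ab. if ab \<noteq> e \<and> ab \<noteq> g \<and> far a ab then
       search (\<lambda>b. b \<noteq> a \<and> b \<noteq> q \<and> far b g \<and> far b ab) labels
       else False) labels else False) labels) m) l"

text \<open>In terms of \<open>config2\<close>, \<open>p\<close> and \<open>q\<close> are the labels
  of \<open>w\<close> and \<open>x\<close>, with \<open>l\<close> and \<open>m\<close> available for
  edges there. Each test follows directly on the last choice it involves, so that failing branches
  are cut early.\<close>

definition sol_config2 :: "nat \<Rightarrow> nat \<Rightarrow> nat list \<Rightarrow> nat list \<Rightarrow> bool" where
  "sol_config2 p q l m = search (\<lambda>xv. search (\<lambda>v. if v \<noteq> p \<and> v \<noteq> q \<and> far v xv then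
     search (\<lambda>wv. if wv \<noteq> xv \<and> far v wv then search (\<lambda>wu. if wu \<noteq> wv then
       search (\<lambda>uv. if uv \<noteq> wu \<and> uv \<noteq> wv \<and> uv \<noteq> xv \<and> far v uv then
         search (\<lambda>u. u \<noteq> p \<and> u \<noteq> v \<and> far u wu \<and> far u uv) labels
       else False) labels else False) l else False) l else False) labels) m"

text \<open>Some pairs of lists admit no solution, but for those the already labelled smaller graph cannot
  exist either; \<open>feasible\<close> expresses its labels at the vertex with neighbours labelled \<open>p\<close> and \<open>q\<close>.\<close>

definition feasible :: "nat \<Rightarrow> nat \<Rightarrow> nat list \<Rightarrow> nat list \<Rightarrow> bool" where
  "feasible p q l m = search (\<lambda>e. search (\<lambda>f. if e \<noteq> f then
     search (\<lambda>v. v \<noteq> p \<and> v \<noteq> q \<and> far v e \<and> far v f) labels else False) m) l"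

text \<open>One outer triangle of \<open>config3\<close>: \<open>p\<close> and \<open>u\<close> are
  the labels of \<open>x\<close> and \<open>u\<close>, \<open>xu\<close> and \<open>a\<close> those
  of the edges from \<open>u\<close> to \<open>x\<close> and to the tip. Given these, the tips
  \<open>v1\<close> and \<open>v2\<close> do not influence each other, so each is searched
  separately.\<close>

definition tip :: "nat \<Rightarrow> nat list \<Rightarrow> nat \<Rightarrow> nat \<Rightarrow> nat \<Rightarrow> bool" where
  "tip p l u xu a = search (\<lambda>xv. if xv \<noteq> xu \<and> xv \<noteq> a then
     search (\<lambda>v. v \<noteq> u \<and> v \<noteq> p \<and> far v a \<and> far v xv) labels else False) l"

definition sol_config3 :: "nat \<Rightarrow> nat \<Rightarrow> nat list \<Rightarrow> nat list \<Rightarrow> bool" where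
  "sol_config3 p q l m = search (\<lambda>xu. search (\<lambda>yu. if xu \<noteq> yu then
     search (\<lambda>u. if u \<noteq> p \<and> u \<noteq> q \<and> far u xu \<and> far u yu then
       search (\<lambda>a. if a \<noteq> xu \<and> a \<noteq> yu \<and> far u a then if tip p l u xu a then
         search (\<lambda>b. if b \<noteq> xu \<and> b \<noteq> yu \<and> b \<noteq> a \<and> far u b then tip q m u yu b else False) labels
       else False else False) labels else False) labels else False) m) l"

definition check :: "nat \<Rightarrow> (nat \<Rightarrow> nat \<Rightarrow> nat list \<Rightarrow> nat list \<Rightarrow> bool) \<Rightarrow> nat \<Rightarrow> nat \<Rightarrow> nat \<Rightarrow> bool" where
  "check j P k p q \<longleftrightarrow> list_all (\<lambda>l. list_all (P p q l) (lists_avoiding k q)) (lists_avoiding j p)"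

text \<open>The numbers in this and the next three checks are 4 minus the number of configuration
  edges at the boundary vertex, that is, the most labels that can already be used there.\<close>

lemma check_path: "list_all (\<lambda>p. list_all (check 3 sol_path 3 p) labels) labels"
  by code_simp

lemma check_triangle: "list_all (\<lambda>p. list_all (\<lambda>l. sol_triangle p p l l) (lists_avoiding 2 p)) labels"
  by code_simp

lemma check_config2: "list_all (\<lambda>p. list_all (check 2 (\<lambda>p q l m. if sol_config2 p q l m then True else \<not> feasible p q l m) 3 p) labels) labels"
  by code_simp

lemma check_config3: "list_all (\<lambda>p. list_all (check 2 (\<lambda>p q l m. if sol_config3 p q l m then True else \<not> feasible p q l m) 2 p) labels) labels"
  by code_simp

lemma if_else_False: "(if A then B else False) \<longleftrightarrow> A \<and> B"
  by simp

lemma checkD: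
  assumes "list_all (\<lambda>p. list_all (check j P k p) labels) labels" "p \<le> 6" "q \<le> 6"
    "l \<in> set (lists_avoiding j p)" "m \<in> set (lists_avoiding k q)"
  shows "P p q l m"
  using assms by (simp add: check_def list_all_iff set_labels)

section \<open>From checked lists to arbitrary sets of available labels\<close>

definition allowed :: "nat \<Rightarrow> nat set \<Rightarrow> nat set" where
  "allowed p S = {e. e \<le> 6 \<and> far p e} - S"

lemma list_in_allowed:
  assumes "p \<le> 6" "finite S" "card S \<le> k" "k \<le> 3" "W \<subseteq> allowed p S" "card W \<le> 4 - k"
  obtains l where "l \<in> set (lists_avoiding k p)" "W \<subseteq> set l" "set l \<subseteq> allowed p S"
  by (rule lists_avoiding_complete[OF assms(1-4) assms(5)[unfolded allowed_def] assms(6)])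
     (rule that, simp_all add: allowed_def)

lemma allowed_obtain:
  assumes "p \<le> 6" "finite S" "card S \<le> 3"
  obtains e where "e \<in> allowed p S"
proof (rule lists_avoiding_complete[OF assms, of "{}"])
  fix l assume "set l \<subseteq> {e. e \<le> 6 \<and> far p e} - S" "l \<noteq> []"
  then have "hd l \<in> allowed p S" unfolding allowed_def using hd_in_set by blast
  then show thesis by (rule that)
qed simp_all

lemma extend_path:
  assumes "p \<le> 6" "q \<le> 6" "finite S" "finite T" "card S \<le> 3" "card T \<le> 3"
  shows "\<exists>e\<in>allowed p S. \<exists>g\<in>allowed q T. \<exists>a\<le>6. \<exists>ab\<le>6. \<exists>b\<le>6.
    a \<noteq> p \<and> far a e \<and> ab \<noteq> e \<and> ab \<noteq> g \<and> far a ab \<and> b \<noteq> a \<and> b \<noteq> q \<and> far b g \<and> far b ab"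
proof -
  obtain l where l: "l \<in> set (lists_avoiding 3 p)" "set l \<subseteq> allowed p S"
    using list_in_allowed[of p S 3 "{}"] assms by auto
  obtain m where m: "m \<in> set (lists_avoiding 3 q)" "set m \<subseteq> allowed q T"
    using list_in_allowed[of q T 3 "{}"] assms by auto
  have "sol_path p q l m" by (rule checkD[OF check_path assms(1,2) l(1) m(1)])
  then show ?thesis using l(2) m(2)
    unfolding sol_path_def search_iff if_else_False set_labels atMost_iff by blast
qed

lemma extend_triangle:
  assumes "p \<le> 6" "finite S" "card S \<le> 2"
  shows "\<exists>e\<in>allowed p S. \<exists>g\<in>allowed p S. \<exists>a\<le>6. \<exists>ab\<le>6. \<exists>b\<le>6. e \<noteq> g \<and>
    a \<noteq> p \<and> far a e \<and> ab \<noteq> e \<and> ab \<noteq> g \<and> far a ab \<and> b \<noteq> a \<and> b \<noteq> p \<and> far b g \<and> far b ab"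
proof -
  obtain l where l: "l \<in> set (lists_avoiding 2 p)" "set l \<subseteq> allowed p S"
    using list_in_allowed[of p S 2 "{}"] assms by auto
  have "sol_triangle p p l l" using check_triangle assms(1) l(1) by (simp add: list_all_iff set_labels)
  then show ?thesis using l(2)
    unfolding sol_triangle_def search_iff if_else_False set_labels atMost_iff by blast
qed

text \<open>The labels \<open>e\<close>, \<open>f\<close> and \<open>v\<close> come from the smaller
  graph. Lists that retain \<open>e\<close> and \<open>f\<close> are feasible with \<open>v\<close>
  as witness, which excludes the second alternative in the check.\<close>

lemma feasible_lists:
  assumes "p \<le> 6" "q \<le> 6" "finite S" "finite T" "card S \<le> j" "card T \<le> k" "j \<le> 3" "k \<le> 3"
    and "e \<in> allowed p S" "f \<in> allowed q T" "e \<noteq> f" "v \<le> 6" "v \<noteq> p" "v \<noteq> q" "far v e" "far v f"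
  obtains l m where "l \<in> set (lists_avoiding j p)" "set l \<subseteq> allowed p S"
    "m \<in> set (lists_avoiding k q)" "set m \<subseteq> allowed q T" "feasible p q l m"
proof -
  have "card {e} \<le> 4 - j" "card {f} \<le> 4 - k" using assms(7,8) by auto
  obtain l where l: "l \<in> set (lists_avoiding j p)" "{e} \<subseteq> set l" "set l \<subseteq> allowed p S"
    using list_in_allowed[OF assms(1,3,5,7) _ \<open>card {e} \<le> 4 - j\<close>] assms(9) by blast
  obtain m where m: "m \<in> set (lists_avoiding k q)" "{f} \<subseteq> set m" "set m \<subseteq> allowed q T"
    using list_in_allowed[OF assms(2,4,6,8) _ \<open>card {f} \<le> 4 - k\<close>] assms(10) by blast
  have "feasible p q l m" unfolding feasible_def search_iff using l(2) m(2) assms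
    by (intro bexI[of _ e] bexI[of _ f]) (auto simp: set_labels search_iff)
  then show thesis using that l m by blast
qed

lemma extend_config2:
  assumes "p \<le> 6" "q \<le> 6" "finite S" "finite T" "card S \<le> 2" "card T \<le> 3"
    and "e \<in> allowed p S" "f \<in> allowed q T" "e \<noteq> f" "v\<^sub>0 \<le> 6" "v\<^sub>0 \<noteq> p" "v\<^sub>0 \<noteq> q" "far v\<^sub>0 e" "far v\<^sub>0 f"
  shows "\<exists>wu\<in>allowed p S. \<exists>wv\<in>allowed p S. \<exists>xv\<in>allowed q T. \<exists>uv\<le>6. \<exists>u\<le>6. \<exists>v\<le>6.
    v \<noteq> p \<and> v \<noteq> q \<and> far v xv \<and> wv \<noteq> xv \<and> far v wv \<and> wu \<noteq> wv \<and> uv \<noteq> wu \<and> uv \<noteq> wv \<and> uv \<noteq> xv \<and>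
    far v uv \<and> u \<noteq> p \<and> u \<noteq> v \<and> far u wu \<and> far u uv"
proof -
  have "(2::nat) \<le> 3" "(3::nat) \<le> 3" by simp_all
  obtain l m where l: "l \<in> set (lists_avoiding 2 p)" "set l \<subseteq> allowed p S"
    and m: "m \<in> set (lists_avoiding 3 q)" "set m \<subseteq> allowed q T" and f: "feasible p q l m"
    by (rule feasible_lists[OF assms(1-6) \<open>(2::nat) \<le> 3\<close> \<open>(3::nat) \<le> 3\<close> assms(7-)])
  have "sol_config2 p q l m" using checkD[OF check_config2 assms(1,2) l(1) m(1)] f by (simp split: if_splits)
  then show ?thesis using l(2) m(2)
    unfolding sol_config2_def search_iff if_else_False set_labels atMost_iff by blast
qed

lemma extend_config3:
  assumes "p \<le> 6" "q \<le> 6" "finite S" "finite T" "card S \<le> 2" "card T \<le> 2"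
    and "e \<in> allowed p S" "f \<in> allowed q T" "e \<noteq> f" "v\<^sub>0 \<le> 6" "v\<^sub>0 \<noteq> p" "v\<^sub>0 \<noteq> q" "far v\<^sub>0 e" "far v\<^sub>0 f"
  obtains xu yu xv yv u a b v1 v2 where
    "xu \<in> allowed p S" "xv \<in> allowed p S" "yu \<in> allowed q T" "yv \<in> allowed q T"
    "u \<le> 6" "a \<le> 6" "b \<le> 6" "xu \<noteq> yu" "u \<noteq> p" "u \<noteq> q" "far u xu" "far u yu" "a \<noteq> xu" "a \<noteq> yu" "far u a"
    "b \<noteq> xu" "b \<noteq> yu" "b \<noteq> a" "far u b"
    "v1 \<le> 6" "xv \<noteq> xu" "xv \<noteq> a" "v1 \<noteq> u" "v1 \<noteq> p" "far v1 a" "far v1 xv"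
    "v2 \<le> 6" "yv \<noteq> yu" "yv \<noteq> b" "v2 \<noteq> u" "v2 \<noteq> q" "far v2 b" "far v2 yv"
proof -
  have "(2::nat) \<le> 3" by simp
  obtain l m where l: "l \<in> set (lists_avoiding 2 p)" "set l \<subseteq> allowed p S"
    and m: "m \<in> set (lists_avoiding 2 q)" "set m \<subseteq> allowed q T" and f: "feasible p q l m"
    by (rule feasible_lists[OF assms(1-6) \<open>(2::nat) \<le> 3\<close> \<open>(2::nat) \<le> 3\<close> assms(7-)])
  have "sol_config3 p q l m" using checkD[OF check_config3 assms(1,2) l(1) m(1)] f by (simp split: if_splits)
  then obtain xu yu u a b where 1: "xu \<in> set l" "yu \<in> set m" "u \<le> 6" "a \<le> 6" "b \<le> 6"
    "xu \<noteq> yu" "u \<noteq> p" "u \<noteq> q" "far u xu" "far u yu" "a \<noteq> xu" "a \<noteq> yu" "far u a"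
    "b \<noteq> xu" "b \<noteq> yu" "b \<noteq> a" "far u b" and t: "tip p l u xu a" "tip q m u yu b"
    unfolding sol_config3_def search_iff if_else_False set_labels atMost_iff by blast
  from t(1) obtain xv v1 where 2: "xv \<in> set l" "v1 \<le> 6" "xv \<noteq> xu" "xv \<noteq> a" "v1 \<noteq> u" "v1 \<noteq> p" "far v1 a" "far v1 xv"
    unfolding tip_def search_iff if_else_False set_labels atMost_iff by blast
  from t(2) obtain yv v2 where 3: "yv \<in> set m" "v2 \<le> 6" "yv \<noteq> yu" "yv \<noteq> b" "v2 \<noteq> u" "v2 \<noteq> q" "far v2 b" "far v2 yv"
    unfolding tip_def search_iff if_else_False set_labels atMost_iff by blast
  have "xu \<in> allowed p S" "xv \<in> allowed p S" "yu \<in> allowed q T" "yv \<in> allowed q T"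
    using 1(1,2) 2(1) 3(1) l(2) m(2) by blast+
  from that[OF this 1(3-) 2(2-) 3(2-)] show thesis .
qed

section \<open>Extending labelings\<close>

text \<open>Vertex labels are total, so the induction can delete edges alone: a vertex that becomes
  isolated keeps a label, and may be relabelled without any effect on validity.\<close>

definition valid :: "'a set set \<Rightarrow> ('a \<Rightarrow> nat) \<Rightarrow> ('a set \<Rightarrow> nat) \<Rightarrow> bool" where
  "valid E \<alpha> \<beta> \<longleftrightarrow> (\<forall>v. \<alpha> v \<le> 6) \<and> (\<forall>e\<in>E. \<beta> e \<le> 6 \<and> (\<forall>v\<in>e. far (\<alpha> v) (\<beta> e))) \<and>
     (\<forall>u v. {u, v} \<in> E \<longrightarrow> u \<noteq> v \<longrightarrow> \<alpha> u \<noteq> \<alpha> v) \<and>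
     (\<forall>e\<in>E. \<forall>e'\<in>E. e \<noteq> e' \<and> e \<inter> e' \<noteq> {} \<longrightarrow> \<beta> e \<noteq> \<beta> e')"

lemma validD:
  assumes "valid E \<alpha> \<beta>"
  shows "\<alpha> v \<le> 6" "e \<in> E \<Longrightarrow> \<beta> e \<le> 6" "e \<in> E \<Longrightarrow> v \<in> e \<Longrightarrow> far (\<alpha> v) (\<beta> e)"
    "{u, v} \<in> E \<Longrightarrow> u \<noteq> v \<Longrightarrow> \<alpha> u \<noteq> \<alpha> v"
    "e \<in> E \<Longrightarrow> e' \<in> E \<Longrightarrow> e \<noteq> e' \<Longrightarrow> e \<inter> e' \<noteq> {} \<Longrightarrow> \<beta> e \<noteq> \<beta> e'"
  using assms by (simp_all add: valid_def)

definition used :: "'a set set \<Rightarrow> ('a set \<Rightarrow> nat) \<Rightarrow> 'a \<Rightarrow> nat set" where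
  "used E \<beta> v = \<beta> ` {e \<in> E. v \<in> e}"

lemma used_insert:
  "used (insert {u, v} E) \<beta> w = (if w = u \<or> w = v then insert (\<beta> {u, v}) (used E \<beta> w) else used E \<beta> w)"
  by (auto simp: used_def)

text \<open>An equivalence because it is read in both directions: to extract the constraints met by
  the old labels of kept edges, and to put the edges of a configuration back one at a time.\<close>

lemma valid_insert:
  assumes "u \<noteq> v" "{u, v} \<notin> E"
  shows "valid (insert {u, v} E) \<alpha> \<beta> \<longleftrightarrow> valid E \<alpha> \<beta> \<and> \<beta> {u, v} \<le> 6 \<and> \<alpha> u \<noteq> \<alpha> v \<and>
    far (\<alpha> u) (\<beta> {u, v}) \<and> far (\<alpha> v) (\<beta> {u, v}) \<and> \<beta> {u, v} \<notin> used E \<beta> u \<and> \<beta> {u, v} \<notin> used E \<beta> v"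
    (is "?L \<longleftrightarrow> ?R")
proof
  assume L: ?L
  have "\<beta> {u, v} \<noteq> \<beta> e" if "e \<in> E" "u \<in> e \<or> v \<in> e" for e
  proof (rule validD(5)[OF L])
    show "{u, v} \<noteq> e" "{u, v} \<inter> e \<noteq> {}" using that assms(2) by auto
  qed (use that in simp_all)
  then have "\<beta> {u, v} \<notin> used E \<beta> u" "\<beta> {u, v} \<notin> used E \<beta> v" by (auto simp: used_def)
  moreover have "valid E \<alpha> \<beta>" using L by (simp add: valid_def)
  moreover have "\<alpha> u \<noteq> \<alpha> v" using validD(4)[OF L _ assms(1)] by simp
  ultimately show ?R using validD(2,3)[OF L, of "{u, v}"] by simp
next
  assume R: ?R
  then have val: "valid E \<alpha> \<beta>" by (rule conjunct1)
  have ne: "\<beta> {u, v} \<noteq> \<beta> e" if "e \<in> E" "{u, v} \<inter> e \<noteq> {}" for e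
    using R that by (auto simp: used_def)
  have 1: "\<beta> e \<noteq> \<beta> e'" if "e \<in> insert {u, v} E" "e' \<in> insert {u, v} E" "e \<noteq> e'" "e \<inter> e' \<noteq> {}" for e e'
    using that ne[of e] ne[of e'] validD(5)[OF val, of e e'] by (metis insertE inf_commute)
  have 2: "\<alpha> x \<noteq> \<alpha> y" if "{x, y} \<in> insert {u, v} E" "x \<noteq> y" for x y
  proof (cases "{x, y} \<in> E")
    case True
    then show ?thesis using validD(4)[OF val] that(2) by blast
  next
    case False
    then have "{x, y} = {u, v}" using that(1) by blast
    then have "x = u \<and> y = v \<or> x = v \<and> y = u" by (simp only: doubleton_eq_iff)
    then show ?thesis using R by metis
  qed
  have 3: "\<beta> e \<le> 6 \<and> (\<forall>x\<in>e. far (\<alpha> x) (\<beta> e))" if "e \<in> insert {u, v} E" for e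
    using that R validD(2,3)[OF val] by auto
  show ?L unfolding valid_def using 1 2 3 validD(1)[OF val] by (intro conjI allI ballI impI) simp_all
qed

lemma valid_cong:
  assumes "valid E \<alpha> \<beta>" "\<And>e. e \<in> E \<Longrightarrow> \<beta>' e = \<beta> e" "\<And>v. v \<in> \<Union>E \<Longrightarrow> \<alpha>' v = \<alpha> v" "\<And>v. \<alpha>' v \<le> 6"
  shows "valid E \<alpha>' \<beta>'"
proof -
  have "\<alpha>' u \<noteq> \<alpha>' v" if "{u, v} \<in> E" "u \<noteq> v" for u v
  proof -
    have "\<alpha>' u = \<alpha> u" "\<alpha>' v = \<alpha> v" using that assms(3) by blast+
    then show ?thesis using that assms(1) unfolding valid_def by auto
  qed
  moreover have "far (\<alpha>' v) (\<beta>' e)" if "e \<in> E" "v \<in> e" for e v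
  proof -
    have "\<alpha>' v = \<alpha> v" using that assms(3) by blast
    then show ?thesis using that assms(1) assms(2)[OF that(1)] unfolding valid_def by simp
  qed
  ultimately show ?thesis using assms(1,2,4) unfolding valid_def by simp
qed

lemma used_cong: "(\<And>e. e \<in> E \<Longrightarrow> \<beta>' e = \<beta> e) \<Longrightarrow> used E \<beta>' v = used E \<beta> v"
  by (auto simp: used_def)

lemma used_isolated: "v \<notin> \<Union>E \<Longrightarrow> used E \<beta> v = {}"
  by (auto simp: used_def)

lemma used_finite: "finite E \<Longrightarrow> finite (used E \<beta> v)"
  by (simp add: used_def)

lemma used_card:
  assumes "finite E" "degree E v \<le> 4" "N \<subseteq> E" "\<And>e. e \<in> N \<Longrightarrow> v \<in> e" "E0 \<subseteq> E - N"
  shows "card (used E0 \<beta> v) \<le> 4 - card N"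
proof -
  have fin: "finite N" "finite E0" using assms finite_subset by blast+
  have "card (used E0 \<beta> v) \<le> card {e \<in> E0. v \<in> e}"
    unfolding used_def using fin by (intro card_image_le) simp
  moreover have "card ({e \<in> E0. v \<in> e} \<union> N) = card {e \<in> E0. v \<in> e} + card N"
    using fin assms(5) by (intro card_Un_disjoint) auto
  moreover have "card ({e \<in> E0. v \<in> e} \<union> N) \<le> degree E v"
    unfolding degree_def using assms(1,3,4,5) by (intro card_mono) auto
  ultimately show ?thesis using assms(2) by linarith
qed

text \<open>Makes the inner vertices of a configuration free for relabeling: they have no edge left
  and no label used.\<close>

lemma isolated_if:
  assumes "\<And>e. e \<in> E \<Longrightarrow> card e = 2" "nbrs_in E u S" "\<And>z. z \<in> S \<Longrightarrow> {u, z} \<in> N"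
  shows "u \<notin> \<Union>(E - N)"
proof
  assume "u \<in> \<Union>(E - N)"
  then obtain e where e: "e \<in> E" "e \<notin> N" "u \<in> e" by blast
  then obtain z where "e = {u, z}" using assms(1)[OF e(1)] by (auto simp: card_2_iff)
  then show False using e assms(2,3) by (auto simp: nbrs_in_def)
qed

section \<open>Extension over a pendant edge and over each configuration\<close>

lemma extend_pendant:
  assumes E: "finite E" "\<And>v. degree E v \<le> 4" "\<And>e. e \<in> E \<Longrightarrow> card e = 2"
    and uv: "{u, v} \<in> E" "nbrs_in E u {v}" and val: "valid (E - {{u, v}}) \<alpha> \<beta>"
  shows "\<exists>\<alpha> \<beta>. valid E \<alpha> \<beta>"
proof -
  let ?E0 = "E - {{u, v}}"
  have ne: "u \<noteq> v" using E(3)[OF uv(1)] by auto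
  have iso: "u \<notin> \<Union>?E0" by (rule isolated_if[OF E(3) uv(2)]) auto
  have "card (used ?E0 \<beta> v) \<le> 4 - card {{u, v}}"
    by (rule used_card[OF E(1) E(2)]) (use uv in auto)
  moreover have lab: "\<alpha> v \<le> 6" using val by (simp add: valid_def)
  moreover have "finite (used ?E0 \<beta> v)" using E(1) by (simp add: used_finite)
  ultimately obtain e where e: "e \<in> allowed (\<alpha> v) (used ?E0 \<beta> v)"
    using allowed_obtain[of "\<alpha> v" "used ?E0 \<beta> v"] by auto
  \<comment> \<open>Distance is symmetric, so the lemma on edge labels also yields a vertex label:
    far from \<open>e\<close> and different from the label of \<open>v\<close>.\<close>
  obtain a where a: "a \<in> allowed e {\<alpha> v}"
    using allowed_obtain[of e "{\<alpha> v}"] e by (auto simp: allowed_def)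
  let ?\<alpha> = "\<alpha>(u := a)" and ?\<beta> = "\<beta>({u, v} := e)"
  have "valid ?E0 ?\<alpha> ?\<beta>"
    by (rule valid_cong[OF val]) (use iso a val in \<open>auto simp: allowed_def valid_def\<close>)
  moreover have "used ?E0 ?\<beta> w = used ?E0 \<beta> w" for w by (rule used_cong) auto
  ultimately have "valid (insert {u, v} ?E0) ?\<alpha> ?\<beta>"
    using ne e a used_isolated[OF iso, of \<beta>]
    by (subst valid_insert) (auto simp: allowed_def far_def)
  then show ?thesis using uv(1) by (metis insert_Diff)
qed

lemma valid_extends_config1:
  assumes E: "finite E" "\<And>v. degree E v \<le> 4" "\<And>e. e \<in> E \<Longrightarrow> card e = 2"
    and c: "config1 E x a b y" and val: "valid (E - {{x, a}, {a, b}, {b, y}}) \<alpha> \<beta>"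
  shows "\<exists>\<alpha> \<beta>. valid E \<alpha> \<beta>"
proof -
  let ?N = "{{x, a}, {a, b}, {b, y}}"
  let ?E0 = "E - ?N"
  have ne: "a \<noteq> b" "a \<noteq> x" "b \<noteq> x" "a \<noteq> y" "b \<noteq> y" and N: "?N \<subseteq> E"
    and nb: "nbrs_in E a {x, b}" "nbrs_in E b {a, y}"
    using c by (auto simp: config1_def)
  have iso: "a \<notin> \<Union>?E0" "b \<notin> \<Union>?E0"
    by (rule isolated_if[OF E(3) nb(1)]; auto simp: insert_commute)
       (rule isolated_if[OF E(3) nb(2)]; auto simp: insert_commute)
  have lab: "\<alpha> x \<le> 6" "\<alpha> y \<le> 6" using val by (auto simp: valid_def)
  have fin: "finite (used ?E0 \<beta> x)" "finite (used ?E0 \<beta> y)" using E(1) by (simp_all add: used_finite)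
  \<comment> \<open>The path and the triangle are merged into one statement. If
    \<open>x = y\<close>, two missing edges meet at \<open>x\<close> and at most two labels are used
    there; otherwise at most three at either end.\<close>
  have "\<exists>e\<in>allowed (\<alpha> x) (used ?E0 \<beta> x). \<exists>g\<in>allowed (\<alpha> y) (used ?E0 \<beta> y). \<exists>la\<le>6. \<exists>m\<le>6. \<exists>lb\<le>6. (x = y \<longrightarrow> e \<noteq> g) \<and>
    la \<noteq> \<alpha> x \<and> far la e \<and> m \<noteq> e \<and> m \<noteq> g \<and> far la m \<and> lb \<noteq> la \<and> lb \<noteq> \<alpha> y \<and> far lb g \<and> far lb m"
  proof (cases "x = y")
    case True
    have "card (used ?E0 \<beta> x) \<le> 4 - card {{x, a}, {b, y}}"
      by (rule used_card[OF E(1,2)]) (use N True in auto)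
    then have "card (used ?E0 \<beta> x) \<le> 2" using ne by (simp add: doubleton_eq_iff)
    from extend_triangle[OF lab(1) fin(1) this] show ?thesis unfolding True by meson
  next
    case False
    have "card (used ?E0 \<beta> x) \<le> 4 - card {{x, a}}" "card (used ?E0 \<beta> y) \<le> 4 - card {{b, y}}"
      by (rule used_card[OF E(1,2)]; use N in auto)+
    then have "card (used ?E0 \<beta> x) \<le> 3" "card (used ?E0 \<beta> y) \<le> 3" by simp_all
    from extend_path[OF lab fin this] show ?thesis using False by meson
  qed
  then obtain e g la m lb where s: "e \<in> allowed (\<alpha> x) (used ?E0 \<beta> x)" "g \<in> allowed (\<alpha> y) (used ?E0 \<beta> y)"
    "la \<le> 6" "m \<le> 6" "lb \<le> 6" "x = y \<Longrightarrow> e \<noteq> g" "la \<noteq> \<alpha> x" "far la e" "m \<noteq> e" "m \<noteq> g" "far la m" "lb \<noteq> la"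
    "lb \<noteq> \<alpha> y" "far lb g" "far lb m" by meson
  define \<alpha>' where "\<alpha>' = \<alpha>(a := la, b := lb)"
  define \<beta>' where "\<beta>' = \<beta>({x, a} := e, {a, b} := m, {b, y} := g)"
  define E0 where "E0 = ?E0"
  have \<alpha>': "\<alpha>' a = la" "\<alpha>' b = lb" "\<alpha>' x = \<alpha> x" "\<alpha>' y = \<alpha> y" using ne by (simp_all add: \<alpha>'_def)
  have \<beta>': "\<beta>' {x, a} = e" "\<beta>' {a, b} = m" "\<beta>' {b, y} = g"
    using ne ne[symmetric] by (auto simp: \<beta>'_def doubleton_eq_iff)
  have v0: "valid E0 \<alpha>' \<beta>'" unfolding E0_def
    by (rule valid_cong[OF val]) (use iso s(3,5) val in \<open>auto simp: valid_def \<alpha>'_def \<beta>'_def\<close>)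
  have u0: "used E0 \<beta>' w = used E0 \<beta> w" for w unfolding E0_def \<beta>'_def by (rule used_cong) auto
  have iso0: "used E0 \<beta> a = {}" "used E0 \<beta> b = {}" using iso by (simp_all add: used_isolated E0_def)
  have al: "e \<le> 6" "far (\<alpha> x) e" "e \<notin> used E0 \<beta> x" "g \<le> 6" "far (\<alpha> y) g" "g \<notin> used E0 \<beta> y"
    using s(1,2) by (auto simp: allowed_def E0_def)
  have notin: "{x, a} \<notin> E0" "{a, b} \<notin> E0" "{b, y} \<notin> E0" by (simp_all add: E0_def)
  have 1: "valid (insert {b, y} E0) \<alpha>' \<beta>'"
    using v0 u0 iso0 \<alpha>' \<beta>' al notin s(3-) ne by (simp add: valid_insert)
  have 2: "valid (insert {a, b} (insert {b, y} E0)) \<alpha>' \<beta>'"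
    using 1 u0 iso0 \<alpha>' \<beta>' al notin s(3-) ne ne[symmetric] by (simp add: valid_insert used_insert doubleton_eq_iff)
  have "valid (insert {x, a} (insert {a, b} (insert {b, y} E0))) \<alpha>' \<beta>'"
    using 2 u0 iso0 \<alpha>' \<beta>' al notin s(3-) ne ne[symmetric]
    by (subst valid_insert) (auto simp: used_insert doubleton_eq_iff)
  moreover have "insert {x, a} (insert {a, b} (insert {b, y} E0)) = E" using N by (auto simp: E0_def)
  ultimately show ?thesis by metis
qed

lemma valid_extends_config2:
  assumes E: "finite E" "\<And>v. degree E v \<le> 4" "\<And>e. e \<in> E \<Longrightarrow> card e = 2"
    and c: "config2 E u v w x" and val: "valid (E - {{u, w}, {u, v}}) \<alpha> \<beta>"
  shows "\<exists>\<alpha> \<beta>. valid E \<alpha> \<beta>"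
proof -
  let ?N = "{{u, w}, {u, v}, {v, w}, {v, x}}"
  let ?E0 = "E - ?N"
  have ne: "u \<noteq> v" "u \<noteq> w" "u \<noteq> x" "v \<noteq> w" "v \<noteq> x" "w \<noteq> x" and N: "?N \<subseteq> E"
    and nb: "nbrs_in E u {v, w}" "nbrs_in E v {u, w, x}"
    using c by (auto simp: config2_def)
  have iso: "u \<notin> \<Union>?E0" "v \<notin> \<Union>?E0"
    by (rule isolated_if[OF E(3) nb(1)]; auto simp: insert_commute)
       (rule isolated_if[OF E(3) nb(2)]; auto simp: insert_commute)
  \<comment> \<open>The smaller graph still contains the path \<open>w v x\<close>. Its labels
    witness feasibility, after which \<open>v\<close> and both edges are relabelled together with
    \<open>u\<close>.\<close>
  have "E - {{u, w}, {u, v}} = insert {v, w} (insert {v, x} ?E0)"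
    using N ne by (auto simp: doubleton_eq_iff)
  then have val': "valid (insert {v, w} (insert {v, x} ?E0)) \<alpha> \<beta>" using val by simp
  then have old: "valid ?E0 \<alpha> \<beta>" "\<alpha> v \<noteq> \<alpha> w" "\<alpha> v \<noteq> \<alpha> x" "far (\<alpha> v) (\<beta> {v, w})" "far (\<alpha> v) (\<beta> {v, x})"
    "\<beta> {v, w} \<in> allowed (\<alpha> w) (used ?E0 \<beta> w)" "\<beta> {v, x} \<in> allowed (\<alpha> x) (used ?E0 \<beta> x)" "\<beta> {v, w} \<noteq> \<beta> {v, x}"
    using ne ne[symmetric] by (simp_all add: valid_insert used_insert doubleton_eq_iff allowed_def)
  have lab: "\<alpha> w \<le> 6" "\<alpha> x \<le> 6" "\<alpha> v \<le> 6" using val by (auto simp: valid_def)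
  have fin: "finite (used ?E0 \<beta> w)" "finite (used ?E0 \<beta> x)" using E(1) by (simp_all add: used_finite)
  have "card (used ?E0 \<beta> w) \<le> 4 - card {{u, w}, {v, w}}" "card (used ?E0 \<beta> x) \<le> 4 - card {{v, x}}"
    by (rule used_card[OF E(1,2)]; use N in auto)+
  then have "card (used ?E0 \<beta> w) \<le> 2" "card (used ?E0 \<beta> x) \<le> 3" using ne by (simp_all add: doubleton_eq_iff)
  from extend_config2[OF lab(1,2) fin this old(6,7,8) lab(3) old(2,3,4,5)]
  obtain wu wv xv uv lu lv where s: "wu \<in> allowed (\<alpha> w) (used ?E0 \<beta> w)" "wv \<in> allowed (\<alpha> w) (used ?E0 \<beta> w)"
    "xv \<in> allowed (\<alpha> x) (used ?E0 \<beta> x)" "uv \<le> 6" "lu \<le> 6" "lv \<le> 6" "lv \<noteq> \<alpha> w" "lv \<noteq> \<alpha> x" "far lv xv" "wv \<noteq> xv"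
    "far lv wv" "wu \<noteq> wv" "uv \<noteq> wu" "uv \<noteq> wv" "uv \<noteq> xv" "far lv uv" "lu \<noteq> \<alpha> w" "lu \<noteq> lv" "far lu wu" "far lu uv"
    by meson
  let ?\<alpha> = "\<alpha>(u := lu, v := lv)" and ?\<beta> = "\<beta>({u, w} := wu, {u, v} := uv, {v, w} := wv, {v, x} := xv)"
  have v0: "valid ?E0 ?\<alpha> ?\<beta>"
    by (rule valid_cong[OF old(1)]) (use iso s(5,6) val in \<open>auto simp: valid_def\<close>)
  have u0: "used ?E0 ?\<beta> z = used ?E0 \<beta> z" for z by (rule used_cong) auto
  have iso0: "used ?E0 \<beta> u = {}" "used ?E0 \<beta> v = {}" using iso by (simp_all add: used_isolated)
  have al: "wu \<le> 6" "far (\<alpha> w) wu" "wu \<notin> used ?E0 \<beta> w" "wv \<le> 6" "far (\<alpha> w) wv" "wv \<notin> used ?E0 \<beta> w"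
    "xv \<le> 6" "far (\<alpha> x) xv" "xv \<notin> used ?E0 \<beta> x"
    using s(1,2,3) by (auto simp: allowed_def)
  have "valid (insert {u, w} (insert {u, v} (insert {v, w} (insert {v, x} ?E0)))) ?\<alpha> ?\<beta>"
    using v0 u0 iso0 s(4-) al ne ne[symmetric]
    by (simp add: valid_insert used_insert doubleton_eq_iff)
  moreover have "insert {u, w} (insert {u, v} (insert {v, w} (insert {v, x} ?E0))) = E" using N by auto
  ultimately show ?thesis by metis
qed

lemma valid_extends_config3:
  assumes E: "finite E" "\<And>v. degree E v \<le> 4" "\<And>e. e \<in> E \<Longrightarrow> card e = 2"
    and c: "config3 E u v1 v2 x y" and val: "valid (E - {{u, v1}, {u, v2}, {v1, x}, {v2, y}}) \<alpha> \<beta>"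
  shows "\<exists>\<alpha> \<beta>. valid E \<alpha> \<beta>"
proof -
  let ?N = "{{u, v1}, {u, v2}, {v1, x}, {v2, y}, {u, x}, {u, y}}"
  let ?E0 = "E - ?N"
  have ne: "u \<noteq> v1" "u \<noteq> v2" "u \<noteq> x" "u \<noteq> y" "v1 \<noteq> v2" "v1 \<noteq> x" "v1 \<noteq> y" "v2 \<noteq> x" "v2 \<noteq> y" "x \<noteq> y"
    and N: "?N \<subseteq> E" and nb: "nbrs_in E u {v1, v2, x, y}" "nbrs_in E v1 {u, x}" "nbrs_in E v2 {u, y}"
    using c by (auto simp: config3_def)
  have iso: "u \<notin> \<Union>?E0" "v1 \<notin> \<Union>?E0" "v2 \<notin> \<Union>?E0"
    by (rule isolated_if[OF E(3) nb(1)]; auto simp: insert_commute)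
       ((rule isolated_if[OF E(3) nb(2)]; auto simp: insert_commute),
        (rule isolated_if[OF E(3) nb(3)]; auto simp: insert_commute))
  \<comment> \<open>Here the kept path is \<open>x u y\<close>; the old labels of \<open>u\<close>
    and of its two edges witness feasibility and are then replaced.\<close>
  have "E - {{u, v1}, {u, v2}, {v1, x}, {v2, y}} = insert {u, x} (insert {u, y} ?E0)"
    using N ne by (auto simp: doubleton_eq_iff)
  then have val': "valid (insert {u, x} (insert {u, y} ?E0)) \<alpha> \<beta>" using val by simp
  then have old: "valid ?E0 \<alpha> \<beta>" "\<alpha> u \<noteq> \<alpha> x" "\<alpha> u \<noteq> \<alpha> y" "far (\<alpha> u) (\<beta> {u, x})" "far (\<alpha> u) (\<beta> {u, y})"
    "\<beta> {u, x} \<in> allowed (\<alpha> x) (used ?E0 \<beta> x)" "\<beta> {u, y} \<in> allowed (\<alpha> y) (used ?E0 \<beta> y)" "\<beta> {u, x} \<noteq> \<beta> {u, y}"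
    using ne ne[symmetric] by (simp_all add: valid_insert used_insert doubleton_eq_iff allowed_def)
  have lab: "\<alpha> x \<le> 6" "\<alpha> y \<le> 6" "\<alpha> u \<le> 6" using val by (auto simp: valid_def)
  have fin: "finite (used ?E0 \<beta> x)" "finite (used ?E0 \<beta> y)" using E(1) by (simp_all add: used_finite)
  have "card (used ?E0 \<beta> x) \<le> 4 - card {{u, x}, {v1, x}}" "card (used ?E0 \<beta> y) \<le> 4 - card {{u, y}, {v2, y}}"
    by (rule used_card[OF E(1,2)]; use N in auto)+
  then have card: "card (used ?E0 \<beta> x) \<le> 2" "card (used ?E0 \<beta> y) \<le> 2" using ne by (simp_all add: doubleton_eq_iff)
  obtain xu yu xv yv lu a b l1 l2 where
    s: "xu \<in> allowed (\<alpha> x) (used ?E0 \<beta> x)" "xv \<in> allowed (\<alpha> x) (used ?E0 \<beta> x)"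
      "yu \<in> allowed (\<alpha> y) (used ?E0 \<beta> y)" "yv \<in> allowed (\<alpha> y) (used ?E0 \<beta> y)"
      "lu \<le> 6" "a \<le> 6" "b \<le> 6" and d: "xu \<noteq> yu" "lu \<noteq> \<alpha> x" "lu \<noteq> \<alpha> y" "far lu xu" "far lu yu" "a \<noteq> xu" "a \<noteq> yu"
      "far lu a" "b \<noteq> xu" "b \<noteq> yu" "b \<noteq> a" "far lu b"
    and t1: "l1 \<le> 6" "xv \<noteq> xu" "xv \<noteq> a" "l1 \<noteq> lu" "l1 \<noteq> \<alpha> x" "far l1 a" "far l1 xv"
    and t2: "l2 \<le> 6" "yv \<noteq> yu" "yv \<noteq> b" "l2 \<noteq> lu" "l2 \<noteq> \<alpha> y" "far l2 b" "far l2 yv"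
    by (rule extend_config3[OF lab(1,2) fin card old(6,7,8) lab(3) old(2,3,4,5)])
  let ?\<alpha> = "\<alpha>(u := lu, v1 := l1, v2 := l2)"
    and ?\<beta> = "\<beta>({u, v1} := a, {u, v2} := b, {v1, x} := xv, {v2, y} := yv, {u, x} := xu, {u, y} := yu)"
  have v0: "valid ?E0 ?\<alpha> ?\<beta>"
  proof (rule valid_cong[OF old(1)])
    fix z assume "z \<in> \<Union>?E0"
    then have "z \<noteq> u" "z \<noteq> v1" "z \<noteq> v2" using iso by metis+
    then show "?\<alpha> z = \<alpha> z" by simp
  next
    fix z
    have "\<alpha> z \<le> 6" using val by (simp add: valid_def)
    then show "?\<alpha> z \<le> 6" using s(5) t1(1) t2(1) by simp
  qed simp
  have u0: "used ?E0 ?\<beta> z = used ?E0 \<beta> z" for z by (rule used_cong) auto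
  have iso0: "used ?E0 \<beta> u = {}" "used ?E0 \<beta> v1 = {}" "used ?E0 \<beta> v2 = {}" using iso by (simp_all add: used_isolated)
  have al: "xu \<le> 6" "far (\<alpha> x) xu" "xu \<notin> used ?E0 \<beta> x" "xv \<le> 6" "far (\<alpha> x) xv" "xv \<notin> used ?E0 \<beta> x"
    "yu \<le> 6" "far (\<alpha> y) yu" "yu \<notin> used ?E0 \<beta> y" "yv \<le> 6" "far (\<alpha> y) yv" "yv \<notin> used ?E0 \<beta> y"
    using s(1-4) by (auto simp: allowed_def)
  have "valid (insert {u, v1} (insert {u, v2} (insert {v1, x} (insert {v2, y} (insert {u, x} (insert {u, y} ?E0)))))) ?\<alpha> ?\<beta>"
    using v0 u0 iso0 s(5-) d d(1,2,3,6,7,9,10,11)[symmetric] t1 t1(2,3,4,5)[symmetric] t2 t2(2,3,4,5)[symmetric] al ne ne[symmetric]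
    by (simp add: valid_insert used_insert doubleton_eq_iff)
  moreover have "insert {u, v1} (insert {u, v2} (insert {v1, x} (insert {v2, y} (insert {u, x} (insert {u, y} ?E0))))) = E"
    using N by auto
  ultimately show ?thesis by metis
qed

section \<open>The induction and the theorem\<close>

lemma degree_mono:
  assumes "E' \<subseteq> E" "finite E"
  shows "degree E' v \<le> degree E v"
  unfolding degree_def using assms by (intro card_mono) auto

text \<open>Stated with a degree bound and the two excluded patterns instead of maximum degree 4 and
  a drawing, since these conditions pass to every subset of the edges at once.\<close>

lemma valid_labels_exist:
  assumes "finite E" "\<And>v. degree E v \<le> 4" "\<And>e. e \<in> E \<Longrightarrow> card e = 2" "no_theta E" "no_crossing E"
  shows "\<exists>\<alpha> \<beta>. valid E \<alpha> \<beta>"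
  using assms
proof (induction "card E" arbitrary: E rule: less_induct)
  case less
  have IH: "\<exists>\<alpha> \<beta>. valid (E - N) \<alpha> \<beta>" if "N \<noteq> {}" "N \<subseteq> E" for N
  proof (rule less.hyps)
    show "card (E - N) < card E" using that less.prems(1) by (intro psubset_card_mono) auto
    show "degree (E - N) v \<le> 4" for v
      using degree_mono[of "E - N" E v] less.prems(1) less.prems(2)[of v] by (meson Diff_subset order_trans)
    show "no_theta (E - N)" using less.prems(4) by (rule no_theta_mono) simp
    show "no_crossing (E - N)" using less.prems(5) by (rule no_crossing_mono) simp
  qed (use less.prems in auto)
  consider "E = {}" | u v where "{u, v} \<in> E" "nbrs_in E u {v}" | "has_config E"
  proof (cases "E = {} \<or> (\<exists>u v. {u, v} \<in> E \<and> nbrs_in E u {v})")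
    case False
    have "has_config E"
    proof (rule unavoidable_config[OF less.prems(1) _ less.prems(3) less.prems(4,5)])
      show "\<exists>w. w \<noteq> v \<and> {u, w} \<in> E" if "{u, v} \<in> E" for u v
        using False that by (auto simp: nbrs_in_def)
    qed (use False in auto)
    then show thesis by (rule that(3))
  qed (use that in blast)
  then show ?case
  proof cases
    case 1
    then show ?thesis by (intro exI[of _ "\<lambda>_. 0"] exI) (simp add: valid_def)
  next
    case (2 u v)
    then obtain \<alpha> \<beta> where "valid (E - {{u, v}}) \<alpha> \<beta>" using IH[of "{{u, v}}"] by blast
    then show ?thesis using extend_pendant[OF less.prems(1-3) 2] by blast
  next
    case 3
    then consider x a b y where "config1 E x a b y" | u v w x where "config2 E u v w x"
      | u v1 v2 x y where "config3 E u v1 v2 x y"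
      unfolding has_config_def by blast
    then show ?thesis
    proof cases
      case (1 x a b y)
      then have "{{x, a}, {a, b}, {b, y}} \<subseteq> E" by (simp add: config1_def)
      then obtain \<alpha> \<beta> where "valid (E - {{x, a}, {a, b}, {b, y}}) \<alpha> \<beta>"
        using IH[of "{{x, a}, {a, b}, {b, y}}"] by blast
      then show ?thesis using valid_extends_config1[OF less.prems(1-3) 1] by blast
    next
      case (2 u v w x)
      then have "{{u, w}, {u, v}} \<subseteq> E" by (simp add: config2_def)
      then obtain \<alpha> \<beta> where "valid (E - {{u, w}, {u, v}}) \<alpha> \<beta>"
        using IH[of "{{u, w}, {u, v}}"] by blast
      then show ?thesis using valid_extends_config2[OF less.prems(1-3) 2] by blast
    next
      case (3 u v1 v2 x y)
      then have "{{u, v1}, {u, v2}, {v1, x}, {v2, y}} \<subseteq> E" by (simp add: config3_def)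
      then obtain \<alpha> \<beta> where "valid (E - {{u, v1}, {u, v2}, {v1, x}, {v2, y}}) \<alpha> \<beta>"
        using IH[of "{{u, v1}, {u, v2}, {v1, x}, {v2, y}}"] by blast
      then show ?thesis using valid_extends_config3[OF less.prems(1-3) 3] by blast
    qed
  qed
qed

lemma valid_total_labeling:
  assumes "finite_simple_graph V E" "valid E \<alpha> \<beta>"
  shows "total_labeling_2_1 V E 6 (case_sum \<alpha> \<beta>)"
  unfolding total_labeling_2_1_def
proof (intro conjI ballI impI)
  show "case_sum \<alpha> \<beta> \<in> (V <+> E) \<rightarrow> {0..6}"
    using validD(1,2)[OF assms(2)] by (auto simp: Pi_iff)
next
  fix v e assume "v \<in> V" "e \<in> E" "v \<in> e"
  then have "far (\<alpha> v) (\<beta> e)" using validD(3)[OF assms(2)] by blast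
  then show "2 \<le> \<bar>int (case_sum \<alpha> \<beta> (Inl v)) - int (case_sum \<alpha> \<beta> (Inr e))\<bar>"
    by (auto simp: far_def)
next
  fix u v assume "u \<in> V" "v \<in> V" and uv: "{u, v} \<in> E"
  then have "card {u, v} = 2" using assms(1) by (auto simp: finite_simple_graph_def)
  then have "u \<noteq> v" by auto
  then have "\<alpha> u \<noteq> \<alpha> v" using validD(4)[OF assms(2) uv] by blast
  then show "1 \<le> \<bar>int (case_sum \<alpha> \<beta> (Inl u)) - int (case_sum \<alpha> \<beta> (Inl v))\<bar>" by simp
next
  fix e e' assume "e \<in> E" "e' \<in> E" "e \<noteq> e' \<and> e \<inter> e' \<noteq> {}"
  then have "\<beta> e \<noteq> \<beta> e'" using validD(5)[OF assms(2)] by blast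
  then show "1 \<le> \<bar>int (case_sum \<alpha> \<beta> (Inr e)) - int (case_sum \<alpha> \<beta> (Inr e'))\<bar>" by simp
qed

theorem theorem3:
  fixes V :: "'a set" and E :: "'a set set"
  assumes "finite_simple_graph V E"
    and "outerplanar V E"
    and "max_degree V E = 4"
  shows "total_labeling_number_2_1 V E \<le> 6 \<and> (\<exists>f. total_labeling_2_1 V E 6 f)"
proof -
  have V: "finite V" "\<And>e. e \<in> E \<Longrightarrow> e \<subseteq> V \<and> card e = 2"
    using assms(1) by (auto simp: finite_simple_graph_def)
  then have "finite E" by (meson Pow_iff finite_Pow_iff finite_subset subsetI)
  moreover have "degree E v \<le> 4" for v
  proof (cases "v \<in> V")
    case True
    then have "degree E v \<le> Max (insert 0 (degree E ` V))" using V(1) by (intro Max_ge) auto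
    then show ?thesis using assms(3) by (simp add: max_degree_def)
  next
    case False
    then have "{e \<in> E. v \<in> e} = {}" using V(2) by blast
    then show ?thesis unfolding degree_def by (simp only: card.empty)
  qed
  ultimately obtain \<alpha> \<beta> where "valid E \<alpha> \<beta>"
    using valid_labels_exist[of E] V(2) outerplanar_excluded[OF assms(1,2)] by blast
  then have ex: "\<exists>f. total_labeling_2_1 V E 6 f" using valid_total_labeling[OF assms(1)] by blast
  then show ?thesis unfolding total_labeling_number_2_1_def by (auto intro: Least_le)
qed

end
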